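(* Let $n\in\mathbb N$, $m>0$, $s\in\mathbb R\setminus\{0\}$ and let $\kappa\in\mathrm{so}(n)$ be skew-symmetric. The magnetic flow on $\mathbb R^{2n}(\gamma,p)$ $$\dot\gamma=\tfrac1m p,\qquad \dot p=\tfrac sm\kappa p$$ is integrable in the non-commutative sense. Assume moreover, in orthonormal coordinates in which the magnetic form is $\mathbf F=s\sum_{i=1}^{[n/2]}\kappa_{2i-1,2i}\,d\gamma_{2i-1}\wedge d\gamma_{2i}$, that $\kappa_{2i-1,2i}\neq0$ for all $i=1,\dots,[n/2]$. Then for even $n$, generic motions are quasi-periodic over $n/2$-dimensional isotropic tori $\mathbb T^{n/2}$, while for odd $n$, generic motions are quasi-periodic over isotropic cylinders $\mathbb T^{[n/2]}\times\mathbb R$.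
   Context: Setting. $\mathbb R^{2n}$ with coordinates $(\gamma,p)$ carries the twisted symplectic form $\Omega+\mathbf F$, where $\Omega=\sum_i dp_i\wedge d\gamma_i$ and $\mathbf F=s\sum_{i<j}\kappa_{ij}\,d\gamma_i\wedge d\gamma_j$ is a constant (homogeneous) magnetic two-form. The flow in question is the Hamiltonian flow of $H=\frac1{2m}\langle p,p\rangle$ with respect to $\Omega+\mathbf F$ (with the convention $i_{X_H}(\Omega+\mathbf F)=-dH$); it describes a material point of mass $m$ in a homogeneous magnetic field in $\mathbb R^n$. By an orthogonal change of coordinates (applied to both $\gamma$ and $p$) $\mathbf F$ can always be brought to the form $s\sum_{i=1}^{[n/2]}\kappa_{2i-1,2i}\,d\gamma_{2i-1}\wedge d\gamma_{2i}$. Integrability. A Hamiltonian system on a $2N$-dimensional symplectic manifold is (completely) integrable in the non-commutative sense if it has an algebra $\mathcal F$ of first integrals, closed under the Poisson bracket, with $\mathrm{ddim}\,\mathcal F+\mathrm{dind}\,\mathcal F=2N$, where $\mathrm{ddim}\,\mathcal F$ is the dimension of the span of the differentials $df(x)$, $f\in\mathcal F$, at generic $x$, and $\mathrm{dind}\,\mathcal F$ is the dimension, at generic $x$, of the kernel of the Poisson tensor restricted to that span. Then regular compact connected common level sets of $\mathcal F$ are isotropic tori of dimension $\mathrm{dind}\,\mathcal F$ (cylinders in the non-compact case with complete flows), on which the motion is linear in suitable coordinates; this is what is meant by quasi-periodic over tori or cylinders. *)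

theory Defs
  imports "HOL-Analysis.Analysis"
begin

text \<open>On a finite-dimensional space a function is of class \<open>C\<^sup>k\<^sup>+\<^sup>1\<close> iff it is differentiable and
  all its directional derivatives are of class \<open>C\<^sup>k\<close>.\<close>

primrec C_k :: "nat \<Rightarrow> ('a::euclidean_space \<Rightarrow> 'b::real_normed_vector) \<Rightarrow> bool" where
  "C_k 0 f \<longleftrightarrow> continuous_on UNIV f"
| "C_k (Suc k) f \<longleftrightarrow>
     (\<forall>x. f differentiable (at x)) \<and> (\<forall>v. C_k k (\<lambda>x. frechet_derivative f (at x) v))"

definition smooth :: "('a::euclidean_space \<Rightarrow> 'b::real_normed_vector) \<Rightarrow> bool" where
  "smooth f \<longleftrightarrow> (\<forall>k. C_k k f)"

definition differential :: "('a::euclidean_space \<Rightarrow> real) \<Rightarrow> 'a \<Rightarrow> ('a \<Rightarrow>\<^sub>L real)" where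
  "differential f x = Blinfun (frechet_derivative f (at x))"

definition generic :: "('a::topological_space \<Rightarrow> bool) \<Rightarrow> bool" where
  "generic P \<longleftrightarrow> (\<exists>U. open U \<and> closure U = UNIV \<and> (\<forall>x\<in>U. P x))"

definition integral_curve :: "('a::real_normed_vector \<Rightarrow> 'a) \<Rightarrow> (real \<Rightarrow> 'a) \<Rightarrow> bool" where
  "integral_curve V c \<longleftrightarrow> (\<forall>t. (c has_vector_derivative V (c t)) (at t))"


subsection \<open>Hamiltonian systems on a symplectic vector space\<close>

text \<open>The forms have constant coefficients, so they are bilinear forms on the phase space and
  closedness is automatic.\<close>

definition symplectic_form :: "('a::euclidean_space \<Rightarrow> 'a \<Rightarrow> real) \<Rightarrow> bool" where
  "symplectic_form \<omega> \<longleftrightarrow>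
     bilinear \<omega> \<and> (\<forall>u. \<omega> u u = 0) \<and> (\<forall>u. (\<forall>v. \<omega> u v = 0) \<longrightarrow> u = 0)"

definition hamiltonian_field ::
  "('a::euclidean_space \<Rightarrow> 'a \<Rightarrow> real) \<Rightarrow> ('a \<Rightarrow> real) \<Rightarrow> ('a \<Rightarrow> 'a) \<Rightarrow> bool" where
  "hamiltonian_field \<omega> H V \<longleftrightarrow> (\<forall>x u. \<omega> (V x) u = - blinfun_apply (differential H x) u)"

text \<open>The vector dual to a covector, with the sign for which \<open>sharp \<omega> (differential f x)\<close> is the
  value at \<open>x\<close> of the Hamiltonian vector field of \<open>f\<close>.\<close>

definition sharp :: "('a::euclidean_space \<Rightarrow> 'a \<Rightarrow> real) \<Rightarrow> ('a \<Rightarrow>\<^sub>L real) \<Rightarrow> 'a" where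
  "sharp \<omega> \<alpha> = (THE v. \<forall>u. \<omega> v u = - blinfun_apply \<alpha> u)"

definition poisson_tensor ::
  "('a::euclidean_space \<Rightarrow> 'a \<Rightarrow> real) \<Rightarrow> ('a \<Rightarrow>\<^sub>L real) \<Rightarrow> ('a \<Rightarrow>\<^sub>L real) \<Rightarrow> real" where
  "poisson_tensor \<omega> \<alpha> \<beta> = \<omega> (sharp \<omega> \<alpha>) (sharp \<omega> \<beta>)"

definition poisson_bracket ::
  "('a::euclidean_space \<Rightarrow> 'a \<Rightarrow> real) \<Rightarrow> ('a \<Rightarrow> real) \<Rightarrow> ('a \<Rightarrow> real) \<Rightarrow> 'a \<Rightarrow> real" where
  "poisson_bracket \<omega> f g x = poisson_tensor \<omega> (differential f x) (differential g x)"

definition first_integral :: "('a::euclidean_space \<Rightarrow> 'a) \<Rightarrow> ('a \<Rightarrow> real) \<Rightarrow> bool" where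
  "first_integral V f \<longleftrightarrow> smooth f \<and> (\<forall>x. blinfun_apply (differential f x) (V x) = 0)"

definition poisson_algebra ::
  "('a::euclidean_space \<Rightarrow> 'a \<Rightarrow> real) \<Rightarrow> ('a \<Rightarrow> real) set \<Rightarrow> bool" where
  "poisson_algebra \<omega> F \<longleftrightarrow>
     (\<lambda>x. 0) \<in> F \<and>
     (\<forall>f\<in>F. \<forall>c. (\<lambda>x. c * f x) \<in> F) \<and>
     (\<forall>f\<in>F. \<forall>g\<in>F. (\<lambda>x. f x + g x) \<in> F \<and> (\<lambda>x. f x * g x) \<in> F \<and> poisson_bracket \<omega> f g \<in> F)"

definition differential_span ::
  "('a::euclidean_space \<Rightarrow> real) set \<Rightarrow> 'a \<Rightarrow> ('a \<Rightarrow>\<^sub>L real) set" where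
  "differential_span F x = span ((\<lambda>f. differential f x) ` F)"

definition poisson_kernel ::
  "('a::euclidean_space \<Rightarrow> 'a \<Rightarrow> real) \<Rightarrow> ('a \<Rightarrow>\<^sub>L real) set \<Rightarrow> ('a \<Rightarrow>\<^sub>L real) set" where
  "poisson_kernel \<omega> S = {\<alpha>\<in>S. \<forall>\<beta>\<in>S. poisson_tensor \<omega> \<alpha> \<beta> = 0}"

text \<open>\<open>ddim\<close> and \<open>dind\<close> as relations, since a set of functions need not have constant rank on an
  open dense set.\<close>

definition has_ddim :: "('a::euclidean_space \<Rightarrow> real) set \<Rightarrow> nat \<Rightarrow> bool" where
  "has_ddim F d \<longleftrightarrow> generic (\<lambda>x. dim (differential_span F x) = d)"

definition has_dind ::
  "('a::euclidean_space \<Rightarrow> 'a \<Rightarrow> real) \<Rightarrow> ('a \<Rightarrow> real) set \<Rightarrow> nat \<Rightarrow> bool" where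
  "has_dind \<omega> F r \<longleftrightarrow> generic (\<lambda>x. dim (poisson_kernel \<omega> (differential_span F x)) = r)"

definition nc_integrable_by ::
  "('a::euclidean_space \<Rightarrow> 'a \<Rightarrow> real) \<Rightarrow> ('a \<Rightarrow> real) \<Rightarrow> ('a \<Rightarrow> 'a) \<Rightarrow> ('a \<Rightarrow> real) set \<Rightarrow> bool" where
  "nc_integrable_by \<omega> H V F \<longleftrightarrow>
     symplectic_form \<omega> \<and> smooth H \<and> hamiltonian_field \<omega> H V \<and>
     (\<forall>f\<in>F. first_integral V f) \<and> poisson_algebra \<omega> F \<and>
     (\<exists>d r. has_ddim F d \<and> has_dind \<omega> F r \<and> d + r = DIM('a))"

definition nc_integrable ::
  "('a::euclidean_space \<Rightarrow> 'a \<Rightarrow> real) \<Rightarrow> ('a \<Rightarrow> real) \<Rightarrow> ('a \<Rightarrow> 'a) \<Rightarrow> bool" where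
  "nc_integrable \<omega> H V \<longleftrightarrow> (\<exists>F. nc_integrable_by \<omega> H V F)"


subsection \<open>Quasi-periodic motion over isotropic tori and cylinders\<close>

text \<open>
  \<open>M\<close> is an embedded isotropic submanifold diffeomorphic to \<open>\<real>\<^sup>k / \<Lambda>\<close>, where \<open>\<Lambda>\<close> consists of the
  vectors with entries in \<open>2\<pi>\<int>\<close> at the indices in \<open>J\<close> and entries \<open>0\<close> elsewhere. This quotient is
  the product of a torus of dimension \<open>card J\<close> and a real vector space of dimension
  \<open>CARD('k) - card J\<close>. The map \<open>\<Phi>\<close> is the composition of the projection onto the quotient with
  the embedding; in the coordinates \<open>\<theta>\<close> the motions on \<open>M\<close> are the lines with constant velocity
  \<open>\<nu>\<close>.
\<close>

definition quasi_periodic_over ::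
  "('a::euclidean_space \<Rightarrow> 'a \<Rightarrow> real) \<Rightarrow> ('a \<Rightarrow> 'a) \<Rightarrow> 'k::finite set \<Rightarrow> 'a set \<Rightarrow> bool" where
  "quasi_periodic_over \<omega> V J M \<longleftrightarrow>
     (\<exists>(\<Phi> :: real^'k \<Rightarrow> 'a) (\<nu> :: real^'k).
        smooth \<Phi> \<and>
        quotient_map euclidean (top_of_set M) \<Phi> \<and>
        (\<forall>\<theta> \<theta>'. \<Phi> \<theta> = \<Phi> \<theta>' \<longleftrightarrow>
           (\<forall>j\<in>J. \<exists>z::int. \<theta> $ j - \<theta>' $ j = 2 * pi * of_int z) \<and> (\<forall>j\<in>-J. \<theta> $ j = \<theta>' $ j)) \<and>
        (\<forall>\<theta>. inj (frechet_derivative \<Phi> (at \<theta>))) \<and>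
        (\<forall>\<theta> u v. \<omega> (frechet_derivative \<Phi> (at \<theta>) u) (frechet_derivative \<Phi> (at \<theta>) v) = 0) \<and>
        (\<forall>\<theta> c. c 0 = \<Phi> \<theta> \<longrightarrow> (integral_curve V c \<longleftrightarrow> (\<forall>t. c t = \<Phi> (\<theta> + t *\<^sub>R \<nu>)))))"

definition level_component :: "('a::topological_space \<Rightarrow> real) set \<Rightarrow> 'a \<Rightarrow> 'a set" where
  "level_component F x = connected_component_set {y. \<forall>f\<in>F. f y = f x} x"

definition generic_motions_quasi_periodic ::
  "('a::euclidean_space \<Rightarrow> 'a \<Rightarrow> real) \<Rightarrow> ('a \<Rightarrow> real) \<Rightarrow> ('a \<Rightarrow> 'a) \<Rightarrow> 'k::finite set \<Rightarrow> bool" where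
  "generic_motions_quasi_periodic \<omega> H V J \<longleftrightarrow>
     (\<exists>F. nc_integrable_by \<omega> H V F \<and>
          generic (\<lambda>x. quasi_periodic_over \<omega> V J (level_component F x)))"


subsection \<open>The magnetic system\<close>

text \<open>Points of the phase space are pairs \<open>(\<gamma>, p)\<close>. The linear order on the index type only serves
  to write sums over \<open>i < j\<close>.\<close>

type_synonym 'n matrix = "real^'n^'n"
type_synonym 'n phase = "(real^'n) \<times> (real^'n)"

definition wedge :: "('a \<Rightarrow> real) \<Rightarrow> ('a \<Rightarrow> real) \<Rightarrow> 'a \<Rightarrow> 'a \<Rightarrow> real" where
  "wedge \<alpha> \<beta> u v = \<alpha> u * \<beta> v - \<alpha> v * \<beta> u"

definition canonical_form :: "('n::finite) phase \<Rightarrow> ('n::finite) phase \<Rightarrow> real" where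
  "canonical_form x y = (\<Sum>i\<in>UNIV. wedge (\<lambda>w. snd w $ i) (\<lambda>w. fst w $ i) x y)"

definition magnetic_form ::
  "real \<Rightarrow> ('n::{finite,linorder}) matrix \<Rightarrow> (real, 'n) vec \<Rightarrow> (real, 'n) vec \<Rightarrow> real" where
  "magnetic_form s \<kappa> u v =
     s * (\<Sum>(i, j) \<in> {(i, j). i < j}. \<kappa> $ i $ j * wedge (\<lambda>w. w $ i) (\<lambda>w. w $ j) u v)"

definition twisted_form ::
  "real \<Rightarrow> ('n::{finite,linorder}) matrix \<Rightarrow> ('n::{finite,linorder}) phase \<Rightarrow> ('n::{finite,linorder}) phase \<Rightarrow> real" where
  "twisted_form s \<kappa> x y = canonical_form x y + magnetic_form s \<kappa> (fst x) (fst y)"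

definition kinetic_energy :: "real \<Rightarrow> ('n::finite) phase \<Rightarrow> real" where
  "kinetic_energy m x = 1 / (2 * m) * (snd x \<bullet> snd x)"

definition magnetic_field ::
  "real \<Rightarrow> real \<Rightarrow> ('n::finite) matrix \<Rightarrow> ('n::finite) phase \<Rightarrow> ('n::finite) phase" where
  "magnetic_field m s \<kappa> x = ((1 / m) *\<^sub>R snd x, (s / m) *\<^sub>R (\<kappa> *v snd x))"

text \<open>The orthonormal basis \<open>b 1, ..., b n\<close> has coordinate functions \<open>\<lambda>w. b i \<bullet> w\<close>, and
  \<open>k i\<close> is the coefficient of the magnetic form with indices \<open>2 * i - 1\<close> and \<open>2 * i\<close>.\<close>

definition normal_coordinates ::
  "real \<Rightarrow> ('n::{finite,linorder}) matrix \<Rightarrow> (nat \<Rightarrow> (real, 'n) vec) \<Rightarrow> (nat \<Rightarrow> real) \<Rightarrow> bool" where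
  "normal_coordinates s \<kappa> b k \<longleftrightarrow>
     (\<forall>i\<in>{1..CARD('n)}. \<forall>j\<in>{1..CARD('n)}. b i \<bullet> b j = (if i = j then 1 else 0)) \<and>
     (\<forall>u v. magnetic_form s \<kappa> u v =
        s * (\<Sum>i = 1..CARD('n) div 2.
               k i * wedge (\<lambda>w. b (2 * i - 1) \<bullet> w) (\<lambda>w. b (2 * i) \<bullet> w) u v))"

end

theory Submission
  imports Defs
begin

text \<open>
  Put \<open>A = s \<kappa>\<close>. The magnetic momentum \<open>p - A \<gamma>\<close> is conserved; its components form the first family
  of integrals. An orthonormal frame \<open>(a i, c i)\<close> of the range of \<open>A\<close> in which \<open>A\<close> is block diagonal
  gives a second family, the squared norms of the projections of \<open>p\<close> to the invariant planes. These
  commute with each other and with the magnetic momentum, so with \<open>r\<close> planes the polynomials in both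
  families have \<open>ddim = n + r\<close> and \<open>dind = r + (n - 2 r) = n - r\<close>: the Poisson kernel is spanned by
  the differentials of the \<open>r\<close> squared norms and of the momenta along the kernel of \<open>A\<close>.

  If \<open>A\<close> has rank \<open>n\<close> or \<open>n - 1\<close>, a generic joint level set consists of independent cyclotron circles
  in the planes, one angle per plane, times the free position along the kernel of \<open>A\<close>.
\<close>

subsection \<open>Smooth functions and gradients\<close>

text \<open>Two momenta bracket to the constant \<open>- (A e \<bullet> e')\<close>, so the family
  is non-commutative as soon as \<open>A\<close> is nonzero, and its algebra must contain constants.
  This constant form degenerates exactly along the kernel of \<open>A\<close>, which is why only the
  momenta in those directions enter the Poisson kernel. The integrability claim allows any rank of
  \<open>A\<close>, while the claim on generic motions prescribes coordinates. The locale
  \<open>normal_frame\<close> serves both: it records only the nonzero blocks, over an arbitrary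
  finite index set. The locale \<open>complete_frame\<close> adds a basis of the kernel and indexes
  planes and kernel directions by one type, whose cardinality is then \<open>n - r\<close>, the
  value of \<open>dind\<close>. Level sets are parametrised explicitly, with one angle for each
  plane and one displacement for each kernel direction. The flow is a straight line in these
  parameters whatever rational relations hold between the frequencies.\<close>

lemma C_k_SucI:
  assumes "\<And>x. (f has_derivative D x) (at x)" and "\<And>v. C_k k (\<lambda>x. D x v)"
  shows "C_k (Suc k) f"
proof -
  have "frechet_derivative f (at x) = D x" for x
    using assms(1) frechet_derivative_at by metis
  then show ?thesis
    using assms by (auto simp: differentiable_def)
qed

lemma C_k_Suc_has_derivative:
  assumes "C_k (Suc k) f"
  shows "(f has_derivative frechet_derivative f (at x)) (at x)"
  using assms by (simp add: frechet_derivative_works)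

lemma C_k_Suc_imp_C_k: "C_k (Suc k) f \<Longrightarrow> C_k k f"
proof (induction k arbitrary: f)
  case 0
  then show ?case
    by (auto intro!: continuous_at_imp_continuous_on differentiable_imp_continuous_within)
qed (metis C_k.simps(2))

lemma C_k_const [intro]: "C_k k (\<lambda>x. c)"
proof (induction k arbitrary: c)
  case (Suc k)
  then show ?case by (intro C_k_SucI[where D = "\<lambda>x v. 0"]) auto
qed simp

lemma C_k_add [intro]:
  assumes "C_k k f" "C_k k g"
  shows "C_k k (\<lambda>x. f x + g x)"
  using assms
proof (induction k arbitrary: f g)
  case 0
  then show ?case by (simp add: continuous_on_add)
next
  case (Suc k)
  show ?case
    by (rule C_k_SucI, rule has_derivative_add[OF C_k_Suc_has_derivative C_k_Suc_has_derivative])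
      (use Suc in auto)
qed

text \<open>Each term of the product rule keeps one factor undifferentiated, so the induction step
  also needs the factors themselves in class \<open>k\<close>; \<open>C_k_Suc_imp_C_k\<close>
  supplies this.\<close>

lemma C_k_scaleR [intro]:
  fixes f :: "'a::euclidean_space \<Rightarrow> real"
  assumes "C_k k f" "C_k k g"
  shows "C_k k (\<lambda>x. f x *\<^sub>R g x)"
  using assms
proof (induction k arbitrary: f g)
  case 0
  then show ?case by (simp add: continuous_on_scaleR)
next
  case (Suc k)
  show ?case
    by (rule C_k_SucI, rule has_derivative_scaleR[OF C_k_Suc_has_derivative C_k_Suc_has_derivative])
      (use Suc C_k_Suc_imp_C_k[of k f] C_k_Suc_imp_C_k[of k g] in \<open>auto intro!: C_k_add\<close>)
qed

lemma C_k_bounded_linear [intro]: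
  assumes "bounded_linear f"
  shows "C_k k f"
proof (cases k)
  case 0
  then show ?thesis using assms by (simp add: linear_continuous_on)
next
  case (Suc k')
  then show ?thesis
    using C_k_SucI[of f "\<lambda>x. f"] assms bounded_linear_imp_has_derivative by blast
qed

text \<open>One induction proves both parts because each derivative involves the other function. For
  linear \<open>f\<close> the remaining factor \<open>f v\<close> is constant in
  \<open>x\<close>.\<close>

lemma C_k_sin_cos:
  fixes f :: "'a::euclidean_space \<Rightarrow> real"
  assumes "bounded_linear f"
  shows "C_k k (\<lambda>x. sin (f x)) \<and> C_k k (\<lambda>x. cos (f x))"
proof (induction k)
  case 0
  show ?case
    using linear_continuous_on[OF assms] by (auto intro!: continuous_intros)
next
  case (Suc k)
  note [derivative_intros] = bounded_linear_imp_has_derivative[OF assms]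
  have "C_k (Suc k) (\<lambda>x. sin (f x))"
    by (rule C_k_SucI[where D = "\<lambda>x v. cos (f x) *\<^sub>R f v"])
      (use Suc in \<open>auto intro!: derivative_eq_intros C_k_scaleR[of k _ "\<lambda>_. f v" for v, simplified]\<close>)
  moreover have "C_k (Suc k) (\<lambda>x. cos (f x))"
    by (rule C_k_SucI[where D = "\<lambda>x v. sin (f x) *\<^sub>R - f v"])
      (use Suc in \<open>auto intro!: derivative_eq_intros C_k_scaleR[of k _ "\<lambda>_. - f v" for v, simplified]\<close>)
  ultimately show ?case ..
qed

lemma smooth_const [intro]: "smooth (\<lambda>x. c)"
  and smooth_add [intro]: "smooth f \<Longrightarrow> smooth g \<Longrightarrow> smooth (\<lambda>x. f x + g x)"
  and smooth_bounded_linear: "bounded_linear h \<Longrightarrow> smooth h"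
  by (auto simp: smooth_def)

lemma smooth_scaleR [intro]:
  fixes f :: "'a::euclidean_space \<Rightarrow> real"
  shows "smooth f \<Longrightarrow> smooth g \<Longrightarrow> smooth (\<lambda>x. f x *\<^sub>R g x)"
  by (auto simp: smooth_def)

lemma smooth_mult [intro]:
  fixes f g :: "'a::euclidean_space \<Rightarrow> real"
  shows "smooth f \<Longrightarrow> smooth g \<Longrightarrow> smooth (\<lambda>x. f x * g x)"
  using smooth_scaleR[of f g] by simp

lemma smooth_sin_cos:
  fixes f :: "'a::euclidean_space \<Rightarrow> real"
  assumes "bounded_linear f"
  shows "smooth (\<lambda>x. sin (f x))" "smooth (\<lambda>x. cos (f x))"
  using C_k_sin_cos[OF assms] by (auto simp: smooth_def)

lemma smooth_sum [intro]:
  assumes "\<And>i. i \<in> S \<Longrightarrow> smooth (f i)"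
  shows "smooth (\<lambda>x. \<Sum>i\<in>S. f i x)"
  using assms by (induction S rule: infinite_finite_induct) auto

text \<open>A finite union of hyperplanes is closed and Lebesgue null, so its complement is open and
  dense. All genericity claims below reduce to this.\<close>

lemma generic_Ball_hyperplane:
  fixes a :: "'i \<Rightarrow> 'a::euclidean_space"
  assumes "finite S" and "\<And>i. i \<in> S \<Longrightarrow> a i \<noteq> 0"
  shows "generic (\<lambda>x. \<forall>i\<in>S. a i \<bullet> x \<noteq> 0)"
proof -
  define N where "N = (\<Union>i\<in>S. {x. a i \<bullet> x = 0})"
  have "negligible N"
    unfolding N_def using assms by (auto intro!: negligible_Union negligible_hyperplane)
  then have "interior N = {}"
    using negligible_subset[OF _ interior_subset] open_not_negligible by blast
  then have "closure (- N) = UNIV"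
    by (simp add: closure_complement)
  moreover have "open (- N)"
    unfolding N_def using assms(1) by (intro open_Compl closed_UN) (auto intro: closed_hyperplane)
  ultimately show ?thesis
    unfolding generic_def by (intro exI[of _ "- N"]) (auto simp: N_def)
qed

lemma generic_mono: "generic P \<Longrightarrow> (\<And>x. P x \<Longrightarrow> Q x) \<Longrightarrow> generic Q"
  unfolding generic_def by blast

section \<open>Differentials represented by gradients\<close>

lemma differential_eq:
  assumes "(f has_derivative (\<lambda>u. g \<bullet> u)) (at x)"
  shows "differential f x = blinfun_inner_right g"
proof -
  have "frechet_derivative f (at x) = blinfun_apply (blinfun_inner_right g)"
    using frechet_derivative_at[OF assms] by auto
  then show ?thesis by (metis differential_def blinfun_apply_inverse)
qed

lemma has_gradient_add:
  assumes "(f has_derivative (\<lambda>u. v \<bullet> u)) (at x)" "(g has_derivative (\<lambda>u. w \<bullet> u)) (at x)"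
  shows "((\<lambda>x. f x + g x) has_derivative (\<lambda>u. (v + w) \<bullet> u)) (at x)"
  using has_derivative_add[OF assms] by (simp add: inner_add_left)

lemma has_gradient_mult:
  fixes f g :: "'a::real_inner \<Rightarrow> real"
  assumes "(f has_derivative (\<lambda>u. v \<bullet> u)) (at x)" "(g has_derivative (\<lambda>u. w \<bullet> u)) (at x)"
  shows "((\<lambda>x. f x * g x) has_derivative (\<lambda>u. (f x *\<^sub>R w + g x *\<^sub>R v) \<bullet> u)) (at x)"
  using has_derivative_mult[OF assms] by (simp add: inner_add_left mult.commute)

lemma has_gradient_const: "((\<lambda>x. k) has_derivative (\<lambda>u. 0 \<bullet> u)) (at x)"
  by simp

lemma inj_blinfun_inner_right: "inj (blinfun_inner_right :: 'a::real_inner \<Rightarrow> _)"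
  by (rule injI, metis blinfun_inner_right.rep_eq vector_eq_rdot)

lemma linear_blinfun_inner_right: "linear blinfun_inner_right"
  using bounded_linear_blinfun_inner_right bounded_linear.linear by blast

text \<open>Carries the ranks in \<open>ddim\<close> and \<open>dind\<close> from covectors to
  gradients: an injective linear map sends a basis to a basis of the image.\<close>

lemma dim_image_blinfun_inner_right:
  fixes S :: "'a::euclidean_space set"
  shows "dim (blinfun_inner_right ` S) = dim S"
proof -
  obtain B where B: "B \<subseteq> S" "independent B" "S \<subseteq> span B" "card B = dim S"
    using basis_exists by blast
  have "independent (blinfun_inner_right ` B)"
    using B(2) linear_blinfun_inner_right inj_on_subset[OF inj_blinfun_inner_right]
    by (metis linear_independent_injective_image subset_UNIV)
  moreover have "blinfun_inner_right ` S \<subseteq> span (blinfun_inner_right ` B)"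
    using B(3) linear_blinfun_inner_right by (metis image_mono linear_span_image)
  moreover have "card (blinfun_inner_right ` B) = dim S"
    using B(4) inj_on_subset[OF inj_blinfun_inner_right] by (metis card_image subset_UNIV)
  ultimately show ?thesis
    using B(1) by (intro dim_unique) auto
qed

text \<open>\<open>const\<close> is there because brackets of momenta are constants; with
  \<open>mult\<close> it also gives the zero function and the scalar multiples that
  \<open>poisson_algebra\<close> demands.\<close>

inductive_set generated_algebra :: "('a \<Rightarrow> real) set \<Rightarrow> ('a \<Rightarrow> real) set" for G where
  generator: "g \<in> G \<Longrightarrow> g \<in> generated_algebra G"
| const: "(\<lambda>x. c) \<in> generated_algebra G"
| add: "f \<in> generated_algebra G \<Longrightarrow> g \<in> generated_algebra G \<Longrightarrow> (\<lambda>x. f x + g x) \<in> generated_algebra G"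
| mult: "f \<in> generated_algebra G \<Longrightarrow> g \<in> generated_algebra G \<Longrightarrow> (\<lambda>x. f x * g x) \<in> generated_algebra G"

subsection \<open>Twisted symplectic forms\<close>

lemma orthogonal_image_eq_0_on_spans:
  fixes f :: "'a::real_inner \<Rightarrow> 'a"
  assumes "linear f" and "\<And>x y. x \<in> S \<Longrightarrow> y \<in> S \<Longrightarrow> x \<bullet> f y = 0"
    and "x \<in> span S" "y \<in> span S"
  shows "x \<bullet> f y = 0"
proof -
  have *: "x \<bullet> f y = 0" if "y \<in> S" for y
    using assms(3)
    by (induction rule: span_induct) (auto simp: subspace_def inner_left_distrib assms(2) that)
  show ?thesis
    using assms(4)
    by (induction rule: span_induct)
      (auto simp: * subspace_def inner_right_distrib linear_add linear_scale linear_0 assms(1))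
qed

locale skew_map =
  fixes A :: "'v::euclidean_space \<Rightarrow> 'v"
  assumes linear_A: "linear A" and skew: "A x \<bullet> y = - (x \<bullet> A y)"
begin

lemmas A_simps = linear_add[OF linear_A] linear_diff[OF linear_A] linear_neg[OF linear_A]
  linear_scale[OF linear_A] linear_0[OF linear_A]

lemma skew_self [simp]: "x \<bullet> A x = 0" "A x \<bullet> x = 0"
  using skew[of x x] by (auto simp: inner_commute)

text \<open>For \<open>A = s \<kappa>\<close> the last term is the magnetic two-form, by
  \<open>magnetic_form_eq\<close>. Working with the operator keeps the argument free of
  coordinates.\<close>

definition twisted :: "'v \<times> 'v \<Rightarrow> 'v \<times> 'v \<Rightarrow> real" where
  "twisted x y = snd x \<bullet> fst y - snd y \<bullet> fst x + fst x \<bullet> A (fst y)"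

definition field :: "real \<Rightarrow> 'v \<times> 'v \<Rightarrow> 'v \<times> 'v" where
  "field m x = ((1 / m) *\<^sub>R snd x, (1 / m) *\<^sub>R A (snd x))"

definition energy :: "real \<Rightarrow> 'v \<times> 'v \<Rightarrow> real" where
  "energy m x = 1 / (2 * m) * (snd x \<bullet> snd x)"

lemma symplectic_form_twisted: "symplectic_form twisted"
  unfolding symplectic_form_def
proof (intro conjI allI impI)
  show "bilinear twisted"
    by (auto simp: bilinear_def twisted_def A_simps algebra_simps intro!: linearI)
  show "twisted u u = 0" for u
    by (simp add: twisted_def)
  show "u = 0" if "\<forall>v. twisted u v = 0" for u
  proof -
    \<comment> \<open>A test vector with zero position removes the magnetic term and leaves
      \<open>- (fst u \<bullet> fst u)\<close>.\<close>
    have "fst u = 0"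
      using that[rule_format, of "(0, fst u)"] by (simp add: twisted_def A_simps)
    moreover from this have "snd u = 0"
      using that[rule_format, of "(snd u, 0)"] by (simp add: twisted_def)
    ultimately show ?thesis by (simp add: prod_eq_iff)
  qed
qed

lemma hamiltonian_field_energy:
  "smooth (energy m)" "hamiltonian_field twisted (energy m) (field m)"
proof -
  \<comment> \<open>As a polynomial in coordinates the energy is covered by the rules for sums and
    products.\<close>
  have "energy m = (\<lambda>x. \<Sum>b\<in>Basis. (1 / (2 * m)) * ((snd x \<bullet> b) * (snd x \<bullet> b)))"
    by (auto simp: energy_def fun_eq_iff euclidean_inner[of "snd _" "snd _"] sum_distrib_left)
  moreover have "smooth (\<lambda>x::'v \<times> 'v. snd x \<bullet> b)" for b
    by (intro smooth_bounded_linear bounded_linear_intros)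
  ultimately show "smooth (energy m)"
    by (simp only:) (intro smooth_sum smooth_mult smooth_const)
  have "(energy m has_derivative (\<lambda>u. (0, (1 / m) *\<^sub>R snd x) \<bullet> u)) (at x)" for x
    unfolding energy_def
    by (cases "m = 0") (auto intro!: derivative_eq_intros simp: inner_commute field_simps)
  then have "differential (energy m) x = blinfun_inner_right (0, (1 / m) *\<^sub>R snd x)" for x
    by (rule differential_eq)
  moreover have "snd x \<bullet> A (fst u) = - (A (snd x) \<bullet> fst u)" for x u :: "'v \<times> 'v"
    using skew by simp
  ultimately show "hamiltonian_field twisted (energy m) (field m)"
    by (auto simp: hamiltonian_field_def twisted_def field_def inner_commute)
qed

text \<open>The Poisson tensor transported to gradients, see
  \<open>poisson_tensor_twisted\<close>.\<close>

definition pairing :: "'v \<times> 'v \<Rightarrow> 'v \<times> 'v \<Rightarrow> real" where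
  "pairing g h = fst h \<bullet> snd g - fst g \<bullet> snd h - snd g \<bullet> A (snd h)"

text \<open>Comparing the coefficients of \<open>snd u\<close> and then of \<open>fst u\<close> in
  the defining equation determines the two components; uniqueness is nondegeneracy of
  \<open>twisted\<close>.\<close>

lemma sharp_twisted:
  "sharp twisted (blinfun_inner_right g) = (snd g, A (snd g) - fst g)"
  unfolding sharp_def
proof (rule the_equality)
  show "\<forall>u. twisted (snd g, A (snd g) - fst g) u = - blinfun_apply (blinfun_inner_right g) u"
    using skew[of "snd g"]
    by (auto simp: twisted_def inner_diff_left inner_diff_right inner_prod_def inner_commute)
  then show "v = (snd g, A (snd g) - fst g)"
    if v: "\<forall>u. twisted v u = - blinfun_apply (blinfun_inner_right g) u" for v
  proof -
    have "twisted (v - (snd g, A (snd g) - fst g)) u = 0" for u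
      using v \<open>\<forall>u. twisted (snd g, A (snd g) - fst g) u = _ u\<close> symplectic_form_twisted
      by (simp add: symplectic_form_def bilinear_lsub del: split_paired_All)
    then show ?thesis
      using symplectic_form_twisted unfolding symplectic_form_def by (metis eq_iff_diff_eq_0)
  qed
qed

lemma poisson_tensor_twisted:
  "poisson_tensor twisted (blinfun_inner_right g) (blinfun_inner_right h) = pairing g h"
  using skew[of "snd g" "snd h"]
  by (simp add: poisson_tensor_def sharp_twisted)
    (simp add: twisted_def pairing_def algebra_simps inner_commute)

lemma poisson_bracket_twisted:
  assumes "(f has_derivative (\<lambda>u. v \<bullet> u)) (at x)" "(g has_derivative (\<lambda>u. w \<bullet> u)) (at x)"
  shows "poisson_bracket twisted f g x = pairing v w"
  by (simp add: poisson_bracket_def differential_eq[OF assms(1)] differential_eq[OF assms(2)]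
      poisson_tensor_twisted)

lemma bilinear_pairing: "bilinear pairing"
  by (auto simp: bilinear_def pairing_def A_simps algebra_simps intro!: linearI)

text \<open>By skewness the kernel is the orthogonal complement of the range.\<close>

lemma dim_range_kernel: "dim (range A) + dim {x. A x = 0} = DIM('v)"
proof -
  have "A x = 0" if "\<forall>y. A y \<bullet> x = 0" for x
    using that skew inner_eq_zero_iff by (metis neg_equal_0_iff_equal)
  then have "{x. A x = 0} = {x \<in> UNIV. \<forall>y \<in> range A. orthogonal y x}"
    by (auto simp: orthogonal_def skew)
  then show ?thesis
    using dim_subspace_orthogonal_to_vectors[of "range A" UNIV] linear_A
    by (simp add: linear_subspace_image dim_UNIV)
qed

end

subsection \<open>Non-commutative integrability from a normal frame\<close>

text \<open>Since every block is nonzero, the frame spans the range of \<open>A\<close> and not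
  necessarily the whole space; thus \<open>A\<close> may have any rank.\<close>

locale normal_frame =
  fixes A :: "'v::euclidean_space \<Rightarrow> 'v" and I :: "'i set"
    and a c :: "'i \<Rightarrow> 'v" and \<mu> :: "'i \<Rightarrow> real"
  assumes finite_I [simp]: "finite I"
    and inner_aa: "i \<in> I \<Longrightarrow> j \<in> I \<Longrightarrow> a i \<bullet> a j = (if i = j then 1 else 0)"
    and inner_cc: "i \<in> I \<Longrightarrow> j \<in> I \<Longrightarrow> c i \<bullet> c j = (if i = j then 1 else 0)"
    and inner_ac: "i \<in> I \<Longrightarrow> j \<in> I \<Longrightarrow> a i \<bullet> c j = 0"
    and \<mu>_nonzero: "i \<in> I \<Longrightarrow> \<mu> i \<noteq> 0"
    and A_eq: "A w = (\<Sum>i\<in>I. \<mu> i *\<^sub>R ((c i \<bullet> w) *\<^sub>R a i - (a i \<bullet> w) *\<^sub>R c i))"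
begin

lemma inner_ca: "i \<in> I \<Longrightarrow> j \<in> I \<Longrightarrow> c i \<bullet> a j = 0"
  using inner_ac by (simp add: inner_commute)

sublocale skew_map A
proof (rule skew_map.intro)
  show "linear A"
    unfolding A_eq
    by (intro linearI)
      (auto simp: algebra_simps sum.distrib sum_subtractf scaleR_sum_right)
  show "A x \<bullet> y = - (x \<bullet> A y)" for x y
    unfolding A_eq inner_sum_left inner_sum_right sum_negf[symmetric]
    by (intro sum.cong) (auto simp: algebra_simps inner_commute)
qed

text \<open>\<open>P i\<close> is the orthogonal projection to the plane of \<open>a i\<close> and
  \<open>c i\<close>; \<open>Q i\<close> is that projection followed by the quarter turn through
  which \<open>A\<close> acts there.\<close>

definition P :: "'i \<Rightarrow> 'v \<Rightarrow> 'v" where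
  "P i w = (a i \<bullet> w) *\<^sub>R a i + (c i \<bullet> w) *\<^sub>R c i"

definition Q :: "'i \<Rightarrow> 'v \<Rightarrow> 'v" where
  "Q i w = (c i \<bullet> w) *\<^sub>R a i - (a i \<bullet> w) *\<^sub>R c i"

lemma A_frame:
  assumes "j \<in> I"
  shows "A (a j) = - \<mu> j *\<^sub>R c j" "A (c j) = \<mu> j *\<^sub>R a j"
proof -
  have "A (a j) = (\<Sum>i\<in>I. if i = j then - \<mu> j *\<^sub>R c j else 0)"
    unfolding A_eq using assms by (intro sum.cong) (auto simp: inner_aa inner_ca)
  then show "A (a j) = - \<mu> j *\<^sub>R c j"
    using assms by (simp add: sum.delta')
  have "A (c j) = (\<Sum>i\<in>I. if i = j then \<mu> j *\<^sub>R a j else 0)"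
    unfolding A_eq using assms by (intro sum.cong) (auto simp: inner_cc inner_ac)
  then show "A (c j) = \<mu> j *\<^sub>R a j"
    using assms by (simp add: sum.delta')
qed

lemma A_P: "i \<in> I \<Longrightarrow> A (P i w) = \<mu> i *\<^sub>R Q i w"
  and A_Q: "i \<in> I \<Longrightarrow> A (Q i w) = - \<mu> i *\<^sub>R P i w"
  by (simp_all add: P_def Q_def A_simps A_frame algebra_simps)

lemma inner_PP: "i \<in> I \<Longrightarrow> j \<in> I \<Longrightarrow>
    P i w \<bullet> P j w = (if i = j then (a i \<bullet> w)\<^sup>2 + (c i \<bullet> w)\<^sup>2 else 0)"
  and inner_QQ: "i \<in> I \<Longrightarrow> j \<in> I \<Longrightarrow>
    Q i w \<bullet> Q j w = (if i = j then (a i \<bullet> w)\<^sup>2 + (c i \<bullet> w)\<^sup>2 else 0)"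
  and inner_PQ: "i \<in> I \<Longrightarrow> j \<in> I \<Longrightarrow> P i w \<bullet> Q j w = 0"
  by (auto simp: P_def Q_def algebra_simps inner_aa inner_cc inner_ac inner_ca power2_eq_square)

lemma inner_P_A: "i \<in> I \<Longrightarrow> P i w \<bullet> A v = - \<mu> i * (Q i w \<bullet> v)"
  using skew[of "P i w" v] by (simp add: A_P)

lemma span_frame: "span (a ` I \<union> c ` I) = range A"
proof
  have "a i = A ((1 / \<mu> i) *\<^sub>R c i)" "c i = A ((- 1 / \<mu> i) *\<^sub>R a i)" if "i \<in> I" for i
    using that \<mu>_nonzero[OF that] by (simp_all only: A_simps A_frame) auto
  then have "a ` I \<union> c ` I \<subseteq> range A"
    by blast
  then show "span (a ` I \<union> c ` I) \<subseteq> range A"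
    using linear_A by (simp add: linear_subspace_image span_minimal)
  have "A w \<in> span (a ` I \<union> c ` I)" for w
    unfolding A_eq by (intro span_sum span_scale span_diff) (auto intro!: span_base)
  then show "range A \<subseteq> span (a ` I \<union> c ` I)"
    by blast
qed

lemma dim_range_A: "dim (range A) = 2 * card I"
proof -
  let ?B = "a ` I \<union> c ` I"
  have inj: "inj_on a I" "inj_on c I"
    using inner_aa inner_cc by (intro inj_onI; metis zero_neq_one)+
  have unit: "a i \<bullet> a i = 1" "c i \<bullet> c i = 1" if "i \<in> I" for i
    using that by (simp_all add: inner_aa inner_cc)
  have "a i \<noteq> c j" if "i \<in> I" "j \<in> I" for i j
    using unit(1)[OF that(1)] inner_ac[OF that] by auto
  then have disj: "a ` I \<inter> c ` I = {}"
    by blast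
  have "pairwise orthogonal ?B"
    by (auto simp: pairwise_def orthogonal_def inner_aa inner_cc inner_ac inner_ca)
  moreover have "0 \<notin> ?B"
    using unit by (metis UnE imageE inner_zero_left zero_neq_one)
  ultimately have "dim ?B = card ?B"
    by (intro dim_eq_card_independent pairwise_orthogonal_independent)
  also have "\<dots> = 2 * card I"
    by (simp add: card_Un_disjoint disj card_image inj)
  finally show ?thesis
    by (simp flip: span_frame)
qed

section \<open>The algebra generated by momenta and actions\<close>

definition momentum :: "'v \<Rightarrow> 'v \<times> 'v \<Rightarrow> real" where
  "momentum e x = snd x \<bullet> e + fst x \<bullet> A e"

definition action :: "'i \<Rightarrow> 'v \<times> 'v \<Rightarrow> real" where
  "action i x = (a i \<bullet> snd x)\<^sup>2 + (c i \<bullet> snd x)\<^sup>2"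

definition integrals :: "('v \<times> 'v \<Rightarrow> real) set" where
  "integrals = generated_algebra (range momentum \<union> action ` I)"

text \<open>The gradients of the actions at \<open>x\<close> span \<open>0 \<times> plane_span (snd x)\<close>.\<close>

definition plane_span :: "'v \<Rightarrow> 'v set" where
  "plane_span p = span ((\<lambda>i. P i p) ` I)"

text \<open>The part \<open>(A e, e)\<close> comes from momenta, the part \<open>(0, y)\<close> from
  actions. This is the span of the differentials at every \<open>x\<close>
  (\<open>differential_span_integrals\<close>); only its dimension requires a generic point.\<close>

definition gradients :: "'v \<times> 'v \<Rightarrow> ('v \<times> 'v) set" where
  "gradients x = {(A e, e + y) |e y. y \<in> plane_span (snd x)}"

lemma momentum_derivative: "(momentum e has_derivative (\<lambda>u. (A e, e) \<bullet> u)) (at x)"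
  unfolding momentum_def by (auto intro!: derivative_eq_intros simp: inner_commute inner_prod_def)

lemma action_derivative:
  "(action i has_derivative (\<lambda>u. (0, 2 *\<^sub>R P i (snd x)) \<bullet> u)) (at x)"
  unfolding action_def P_def
  by (auto intro!: derivative_eq_intros simp: inner_commute algebra_simps)

lemma gradients_eq_sum:
  "gradients x = {u + v |u v. u \<in> range (\<lambda>e. (A e, e)) \<and> v \<in> Pair 0 ` plane_span (snd x)}"
  unfolding gradients_def by (auto simp: image_iff)

lemma linear_graph: "linear (\<lambda>e. (A e, e))"
  by (intro linearI) (auto simp: A_simps)

lemma linear_Pair_0: "linear (Pair 0 :: 'v \<Rightarrow> 'v \<times> 'v)"
  by (intro linearI) auto

lemma subspace_plane_span: "subspace (plane_span p)"
  by (simp add: plane_span_def)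

lemma subspace_gradients: "subspace (gradients x)"
  unfolding gradients_eq_sum
  by (intro subspace_sums linear_subspace_image linear_graph linear_Pair_0 subspace_plane_span subspace_UNIV)

lemma momentum_gradient: "(A e, e) \<in> gradients x"
  unfolding gradients_def using subspace_0[OF subspace_plane_span] by force

lemma action_gradient:
  assumes "i \<in> I"
  shows "(0, 2 *\<^sub>R P i (snd x)) \<in> gradients x"
proof -
  have "2 *\<^sub>R P i (snd x) \<in> plane_span (snd x)"
    unfolding plane_span_def using assms by (intro span_scale span_base imageI)
  then have "(A 0, 0 + 2 *\<^sub>R P i (snd x)) \<in> gradients x"
    unfolding gradients_def by blast
  then show ?thesis by (simp add: A_simps)
qed

text \<open>At a fixed point the product rule combines two gradients with scalar coefficients, so
  the induction never leaves the subspace \<open>gradients x\<close>.\<close>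

lemma integrals_gradient:
  assumes "f \<in> integrals"
  obtains g where "\<And>x. g x \<in> gradients x" "\<And>x. (f has_derivative (\<lambda>u. g x \<bullet> u)) (at x)"
proof -
  have "\<exists>g\<in>gradients x. (f has_derivative (\<lambda>u. g \<bullet> u)) (at x)" for x
    using assms unfolding integrals_def
  proof (induction rule: generated_algebra.induct)
    case (generator f)
    then show ?case
      using momentum_derivative momentum_gradient action_derivative action_gradient by blast
  next
    case (const k)
    show ?case
      using subspace_0[OF subspace_gradients] by (intro bexI[of _ 0]) auto
  next
    case (add f1 f2)
    then obtain g1 g2 where g: "g1 \<in> gradients x" "g2 \<in> gradients x"
      and "(f1 has_derivative (\<lambda>u. g1 \<bullet> u)) (at x)" "(f2 has_derivative (\<lambda>u. g2 \<bullet> u)) (at x)"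
      by blast
    then have "((\<lambda>x. f1 x + f2 x) has_derivative (\<lambda>u. (g1 + g2) \<bullet> u)) (at x)"
      by (auto intro!: derivative_eq_intros simp: inner_add_left)
    then show ?case
      using subspace_add[OF subspace_gradients] g by blast
  next
    case (mult f1 f2)
    then obtain g1 g2 where g: "g1 \<in> gradients x" "g2 \<in> gradients x"
      and "(f1 has_derivative (\<lambda>u. g1 \<bullet> u)) (at x)" "(f2 has_derivative (\<lambda>u. g2 \<bullet> u)) (at x)"
      by blast
    then have "((\<lambda>x. f1 x * f2 x) has_derivative (\<lambda>u. (f1 x *\<^sub>R g2 + f2 x *\<^sub>R g1) \<bullet> u)) (at x)"
      by (auto intro!: derivative_eq_intros simp: inner_add_left)
    then show ?case
      using subspace_add[OF subspace_gradients] subspace_scale[OF subspace_gradients] g by blast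
  qed
  then show ?thesis
    using that by metis
qed

lemma smooth_integrals: "f \<in> integrals \<Longrightarrow> smooth f"
  unfolding integrals_def
proof (induction rule: generated_algebra.induct)
  case (generator f)
  have "smooth (momentum e)" for e
    unfolding momentum_def
    by (intro smooth_add smooth_bounded_linear bounded_linear_intros)
  moreover have "smooth (action i)" for i
    unfolding action_def power2_eq_square
    by (intro smooth_add smooth_mult smooth_bounded_linear bounded_linear_intros)
  ultimately show ?case
    using generator by blast
qed auto

section \<open>Closure under the Poisson bracket\<close>

lemma linear_pairing_right: "linear (pairing g)" and linear_pairing_left: "linear (\<lambda>g. pairing g h)"
  using bilinear_pairing by (auto simp: bilinear_def simp del: split_paired_All)

text \<open>A momentum and an action commute because the two surviving terms cancel by skewness; two
  actions commute because \<open>P i w\<close> and \<open>Q j w\<close> are orthogonal.\<close>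

lemma bracket_generators:
  assumes "f \<in> range momentum \<union> action ` I" "g \<in> range momentum \<union> action ` I"
  shows "\<exists>k. poisson_bracket twisted f g = (\<lambda>x. k)"
proof -
  have "poisson_bracket twisted (momentum e) (momentum e') x = - (A e \<bullet> e')" for e e' x
    unfolding poisson_bracket_twisted[OF momentum_derivative momentum_derivative]
    by (simp add: pairing_def inner_commute)
  moreover have "poisson_bracket twisted (momentum e) (action i) x = 0" for e i x
    unfolding poisson_bracket_twisted[OF momentum_derivative action_derivative]
    by (simp add: pairing_def skew A_simps)
  moreover have "poisson_bracket twisted (action i) (momentum e) x = 0" for e i x
    unfolding poisson_bracket_twisted[OF action_derivative momentum_derivative]
    by (simp add: pairing_def inner_commute)
  moreover have "poisson_bracket twisted (action i) (action j) x = 0" if "i \<in> I" "j \<in> I" for i j x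
    unfolding poisson_bracket_twisted[OF action_derivative action_derivative]
    using that by (simp add: pairing_def A_simps A_P inner_PQ)
  ultimately show ?thesis
    using assms by (elim UnE rangeE imageE) (auto intro!: exI ext)
qed

text \<open>The bracket is a derivation in each argument. Induction on the second argument with a
  generator in the first, then induction on the first, reduces it to
  \<open>bracket_generators\<close>.\<close>

lemma bracket_integrals:
  assumes "f \<in> integrals" "g \<in> integrals"
  shows "poisson_bracket twisted f g \<in> integrals"
proof -
  let ?F = "generated_algebra (range momentum \<union> action ` I)"
  note alg = generated_algebra.intros
  have right: "poisson_bracket twisted f g \<in> ?F"
    if f: "f \<in> range momentum \<union> action ` I" and g: "g \<in> ?F" for f g
  proof -
    have "f \<in> ?F" using f by (rule generator)
    then obtain f' where f': "\<And>x. (f has_derivative (\<lambda>u. f' x \<bullet> u)) (at x)"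
      using integrals_gradient unfolding integrals_def by metis
    show ?thesis
      using g
    proof (induction rule: generated_algebra.induct)
      case (generator g)
      then show ?case
        using bracket_generators[OF f generator] const by metis
    next
      case (const k)
      have "poisson_bracket twisted f (\<lambda>x. k) = (\<lambda>x. 0)"
        by (simp add: fun_eq_iff poisson_bracket_twisted[OF f' has_gradient_const]
            linear_0[OF linear_pairing_right])
      then show ?case by (simp add: alg)
    next
      case (add g1 g2)
      then obtain d1 d2 where d: "\<And>x. (g1 has_derivative (\<lambda>u. d1 x \<bullet> u)) (at x)"
        "\<And>x. (g2 has_derivative (\<lambda>u. d2 x \<bullet> u)) (at x)"
        using integrals_gradient unfolding integrals_def by metis
      note D = has_gradient_add[OF d]
      have "poisson_bracket twisted f (\<lambda>x. g1 x + g2 x) =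
          (\<lambda>x. poisson_bracket twisted f g1 x + poisson_bracket twisted f g2 x)"
        by (intro ext) (simp add: poisson_bracket_twisted[OF f' D] poisson_bracket_twisted[OF f' d(1)]
            poisson_bracket_twisted[OF f' d(2)] linear_add[OF linear_pairing_right])
      then show ?case using add by (simp add: alg)
    next
      case (mult g1 g2)
      then obtain d1 d2 where d: "\<And>x. (g1 has_derivative (\<lambda>u. d1 x \<bullet> u)) (at x)"
        "\<And>x. (g2 has_derivative (\<lambda>u. d2 x \<bullet> u)) (at x)"
        using integrals_gradient unfolding integrals_def by metis
      note D = has_gradient_mult[OF d]
      have "poisson_bracket twisted f (\<lambda>x. g1 x * g2 x) =
          (\<lambda>x. g1 x * poisson_bracket twisted f g2 x + g2 x * poisson_bracket twisted f g1 x)"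
        by (intro ext) (simp add: poisson_bracket_twisted[OF f' D] poisson_bracket_twisted[OF f' d(1)]
            poisson_bracket_twisted[OF f' d(2)] linear_add[OF linear_pairing_right]
            linear_scale[OF linear_pairing_right])
      then show ?case using mult by (simp add: alg)
    qed
  qed
  have "g \<in> ?F" using assms(2) by (simp add: integrals_def)
  obtain g' where g': "\<And>x. (g has_derivative (\<lambda>u. g' x \<bullet> u)) (at x)"
    using integrals_gradient assms(2) by metis
  have "f \<in> ?F" using assms(1) by (simp add: integrals_def)
  then have "poisson_bracket twisted f g \<in> ?F"
  proof (induction rule: generated_algebra.induct)
    case (generator f)
    then show ?case using right \<open>g \<in> ?F\<close> by blast
  next
    case (const k)
    have "poisson_bracket twisted (\<lambda>x. k) g = (\<lambda>x. 0)"
      by (simp add: fun_eq_iff poisson_bracket_twisted[OF has_gradient_const g']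
          linear_0[OF linear_pairing_left])
    then show ?case by (simp add: alg)
  next
    case (add f1 f2)
    then obtain d1 d2 where d: "\<And>x. (f1 has_derivative (\<lambda>u. d1 x \<bullet> u)) (at x)"
      "\<And>x. (f2 has_derivative (\<lambda>u. d2 x \<bullet> u)) (at x)"
      using integrals_gradient unfolding integrals_def by metis
    note D = has_gradient_add[OF d]
    have "poisson_bracket twisted (\<lambda>x. f1 x + f2 x) g =
        (\<lambda>x. poisson_bracket twisted f1 g x + poisson_bracket twisted f2 g x)"
      by (intro ext) (simp add: poisson_bracket_twisted[OF D g'] poisson_bracket_twisted[OF d(1) g']
          poisson_bracket_twisted[OF d(2) g'] linear_add[OF linear_pairing_left])
    then show ?case using add by (simp add: alg)
  next
    case (mult f1 f2)
    then obtain d1 d2 where d: "\<And>x. (f1 has_derivative (\<lambda>u. d1 x \<bullet> u)) (at x)"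
      "\<And>x. (f2 has_derivative (\<lambda>u. d2 x \<bullet> u)) (at x)"
      using integrals_gradient unfolding integrals_def by metis
    note D = has_gradient_mult[OF d]
    have "poisson_bracket twisted (\<lambda>x. f1 x * f2 x) g =
        (\<lambda>x. f1 x * poisson_bracket twisted f2 g x + f2 x * poisson_bracket twisted f1 g x)"
      by (intro ext) (simp add: poisson_bracket_twisted[OF D g'] poisson_bracket_twisted[OF d(1) g']
          poisson_bracket_twisted[OF d(2) g'] linear_add[OF linear_pairing_left]
          linear_scale[OF linear_pairing_left])
    then show ?case using mult by (simp add: alg)
  qed
  then show ?thesis by (simp add: integrals_def)
qed

lemma poisson_algebra_integrals: "poisson_algebra twisted integrals"
  unfolding poisson_algebra_def
  using bracket_integrals by (auto simp: integrals_def intro: generated_algebra.intros)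

section \<open>Ranks of the differentials and of the Poisson tensor on them\<close>

lemma inner_plane_span_A:
  assumes "y \<in> plane_span p" "z \<in> plane_span p"
  shows "y \<bullet> A z = 0"
  using assms unfolding plane_span_def
  by (rule orthogonal_image_eq_0_on_spans[OF linear_A, rotated]) (auto simp: A_P inner_PQ)

lemma plane_span_subset_range: "plane_span p \<subseteq> range A"
  unfolding plane_span_def span_frame[symmetric] P_def
  by (intro span_minimal image_subsetI span_add span_scale) (auto intro: span_base)

lemma plane_span_inter_kernel:
  assumes "y \<in> plane_span p" "A y = 0"
  shows "y = 0"
proof -
  obtain z where "y = A z" using assms(1) plane_span_subset_range by blast
  then have "y \<bullet> y = 0" using skew[of z y] assms(2) by simp
  then show ?thesis by simp
qed

text \<open>The vectors \<open>P i p\<close> are pairwise orthogonal. The condition on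
  \<open>a i \<bullet> p\<close> makes them nonzero and describes the complement of hyperplanes, as
  \<open>generic_Ball_hyperplane\<close> wants.\<close>

lemma dim_plane_span:
  assumes "\<And>i. i \<in> I \<Longrightarrow> a i \<bullet> p \<noteq> 0"
  shows "dim (plane_span p) = card I"
proof -
  let ?B = "(\<lambda>i. P i p) ` I"
  have nonzero: "P i p \<bullet> P i p \<noteq> 0" if "i \<in> I" for i
    using that assms[OF that] by (simp add: inner_PP add_nonneg_eq_0_iff)
  then have inj: "inj_on (\<lambda>i. P i p) I"
    using inner_PP by (intro inj_onI) metis
  have "pairwise orthogonal ?B"
    by (auto simp: pairwise_def orthogonal_def inner_PP)
  moreover have "0 \<notin> ?B"
    using nonzero by force
  ultimately have "independent ?B"
    by (rule pairwise_orthogonal_independent)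
  then show ?thesis
    by (simp add: plane_span_def dim_eq_card_independent card_image inj)
qed

lemma dim_gradients:
  assumes "\<And>i. i \<in> I \<Longrightarrow> a i \<bullet> snd x \<noteq> 0"
  shows "dim (gradients x) = DIM('v) + card I"
proof -
  let ?K = "range (\<lambda>e. (A e, e))" and ?L = "Pair 0 ` plane_span (snd x) :: ('v \<times> 'v) set"
  have "?K \<inter> ?L \<subseteq> {0}"
    using plane_span_inter_kernel by (auto simp: zero_prod_def)
  then have "dim (?K \<inter> ?L) = 0"
    by (simp add: dim_eq_0)
  moreover have "subspace ?K" "subspace ?L"
    by (intro linear_subspace_image linear_graph linear_Pair_0 subspace_plane_span subspace_UNIV)+
  then have "dim (gradients x) + dim (?K \<inter> ?L) = dim ?K + dim ?L"
    unfolding gradients_eq_sum by (rule dim_sums_Int)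
  moreover have "dim ?K = DIM('v)"
    by (subst dim_image_eq[OF linear_graph]) (auto simp: inj_on_def dim_UNIV)
  moreover have "dim ?L = card I"
    by (subst dim_image_eq[OF linear_Pair_0]) (auto simp: inj_on_def dim_plane_span assms)
  ultimately show ?thesis by linarith
qed

lemma pairing_gradients:
  assumes "y \<in> plane_span p" "z \<in> plane_span p"
  shows "pairing (A e, e + y) (A f, f + z) = - (A e \<bullet> f)"
  using skew[of e z] skew[of f y] skew[of e f] inner_plane_span_A[OF assms]
  by (simp add: pairing_def A_simps algebra_simps inner_commute)

text \<open>By \<open>pairing_gradients\<close> the action parts drop out and only
  \<open>- (A e \<bullet> f)\<close> remains, so the kernel is \<open>0\<close> times the direct sum
  of the kernel of \<open>A\<close> and \<open>plane_span\<close>. Its dimension is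
  \<open>(n - 2 r) + r\<close>.\<close>

lemma dim_pairing_kernel:
  assumes "\<And>i. i \<in> I \<Longrightarrow> a i \<bullet> snd x \<noteq> 0"
  shows "dim {g \<in> gradients x. \<forall>h \<in> gradients x. pairing g h = 0} = DIM('v) - card I"
proof -
  let ?Y = "plane_span (snd x)" and ?N = "{e. A e = 0}"
  have "(\<forall>h \<in> gradients x. pairing (A e, e + y) h = 0) \<longleftrightarrow> A e = 0" if "y \<in> ?Y" for e y
  proof
    assume *: "\<forall>h \<in> gradients x. pairing (A e, e + y) h = 0"
    \<comment> \<open>Testing against the momentum along \<open>A e\<close> gives
      \<open>- (A e \<bullet> A e)\<close>.\<close>
    have "(A (A e), A e) \<in> gradients x"
      by (rule momentum_gradient)
    then have "A e \<bullet> A e = 0"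
      using * pairing_gradients[OF that subspace_0[OF subspace_plane_span], of e "A e"] by auto
    then show "A e = 0" by simp
  next
    assume "A e = 0"
    then show "\<forall>h \<in> gradients x. pairing (A e, e + y) h = 0"
      using pairing_gradients[OF that, of _ e] by (auto simp: gradients_def)
  qed
  then have "{g \<in> gradients x. \<forall>h \<in> gradients x. pairing g h = 0} =
      Pair 0 ` {e + y |e y. e \<in> ?N \<and> y \<in> ?Y}"
    unfolding gradients_def[of x] by (auto simp: image_iff) metis+
  moreover have "dim (Pair 0 ` {e + y |e y. e \<in> ?N \<and> y \<in> ?Y} :: ('v \<times> 'v) set) =
      dim {e + y |e y. e \<in> ?N \<and> y \<in> ?Y}"
    by (rule dim_image_eq[OF linear_Pair_0]) (auto simp: inj_on_def)
  moreover have "dim {e + y |e y. e \<in> ?N \<and> y \<in> ?Y} + dim (?N \<inter> ?Y) = dim ?N + dim ?Y"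
    by (intro dim_sums_Int subspace_plane_span) (auto simp: subspace_def A_simps)
  moreover have "dim (?N \<inter> ?Y) = 0"
    using plane_span_inter_kernel by (auto simp: dim_eq_0)
  ultimately show ?thesis
    using dim_range_kernel dim_range_A dim_plane_span[OF assms] by simp
qed

lemma differential_span_integrals:
  "differential_span integrals x = blinfun_inner_right ` gradients x"
proof
  have "differential f x \<in> blinfun_inner_right ` gradients x" if "f \<in> integrals" for f
    using integrals_gradient[OF that] differential_eq by (metis image_eqI)
  moreover have "subspace (blinfun_inner_right ` gradients x)"
    by (intro linear_subspace_image linear_blinfun_inner_right subspace_gradients)
  ultimately show "differential_span integrals x \<subseteq> blinfun_inner_right ` gradients x"
    unfolding differential_span_def by (intro span_minimal) auto
  let ?D = "(\<lambda>f. differential f x) ` integrals"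
  have momentum: "blinfun_inner_right (A e, e) \<in> span ?D" for e
    using differential_eq[OF momentum_derivative, of e x]
    by (auto simp: integrals_def intro!: span_base image_eqI[of _ _ "momentum e"] generator)
  have action: "blinfun_inner_right (0, P i (snd x)) \<in> span ?D" if "i \<in> I" for i
  proof -
    have "blinfun_inner_right (0, 2 *\<^sub>R P i (snd x)) \<in> span ?D"
      using differential_eq[OF action_derivative, of i x] that
      by (auto simp: integrals_def intro!: span_base image_eqI[of _ _ "action i"] generator)
    then have "(1 / 2) *\<^sub>R blinfun_inner_right (0, 2 *\<^sub>R P i (snd x)) \<in> span ?D"
      by (rule span_scale)
    then show ?thesis
      by (simp flip: linear_scale[OF linear_blinfun_inner_right])
  qed
  have "subspace {y. blinfun_inner_right (0, y) \<in> span ?D}"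
    using linear_subspace_vimage[OF linear_compose[OF linear_Pair_0 linear_blinfun_inner_right],
        of "span ?D"] by (simp add: vimage_def)
  then have plane: "blinfun_inner_right (0, y) \<in> span ?D" if "y \<in> plane_span (snd x)" for y
    using span_minimal[of "(\<lambda>i. P i (snd x)) ` I" "{y. blinfun_inner_right (0, y) \<in> span ?D}"]
      action that unfolding plane_span_def by blast
  have "blinfun_inner_right (A e, e + y) \<in> span ?D" if "y \<in> plane_span (snd x)" for e y
    using span_add[OF momentum[of e] plane[OF that]]
    by (simp flip: linear_add[OF linear_blinfun_inner_right])
  then show "blinfun_inner_right ` gradients x \<subseteq> differential_span integrals x"
    by (auto simp: gradients_def differential_span_def)
qed

lemma poisson_kernel_integrals:
  "poisson_kernel twisted (differential_span integrals x) =
    blinfun_inner_right ` {g \<in> gradients x. \<forall>h \<in> gradients x. pairing g h = 0}"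
  unfolding poisson_kernel_def differential_span_integrals
  by (auto simp: poisson_tensor_twisted)

lemma generic_frame: "generic (\<lambda>x :: 'v \<times> 'v. \<forall>i\<in>I. a i \<bullet> snd x \<noteq> 0)"
proof -
  have "generic (\<lambda>x. \<forall>i\<in>I. (0, a i) \<bullet> (x :: 'v \<times> 'v) \<noteq> 0)"
    by (intro generic_Ball_hyperplane) (use inner_aa in \<open>force simp: zero_prod_def\<close>)+
  then show ?thesis by (simp add: inner_prod_def)
qed

text \<open>For momenta this is skewness; for actions, the force turns the momentum inside each
  plane, as \<open>Q i p\<close> is orthogonal to \<open>p\<close>.\<close>

lemma field_gradient_orthogonal:
  assumes "g \<in> gradients x"
  shows "g \<bullet> field m x = 0"
proof -
  obtain e y where g: "g = (A e, e + y)" and y: "y \<in> plane_span (snd x)"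
    using assms by (auto simp: gradients_def)
  have "P i (snd x) \<bullet> A (snd x) = 0" if "i \<in> I" for i
    using that by (simp add: inner_P_A) (simp add: Q_def algebra_simps)
  moreover have "subspace {z. z \<bullet> A (snd x) = 0}"
    by (auto simp: subspace_def inner_add_left)
  ultimately have "y \<bullet> A (snd x) = 0"
    using y span_minimal[of "(\<lambda>i. P i (snd x)) ` I" "{z. z \<bullet> A (snd x) = 0}"]
    unfolding plane_span_def by blast
  then show ?thesis
    using skew[of e "snd x"] by (simp add: g field_def inner_add_left field_simps)
qed

lemma first_integral_integrals:
  assumes "f \<in> integrals"
  shows "first_integral (field m) f"
proof -
  obtain g where g: "\<And>x. g x \<in> gradients x" "\<And>x. (f has_derivative (\<lambda>u. g x \<bullet> u)) (at x)"
    using integrals_gradient[OF assms] by blast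
  have "blinfun_apply (differential f x) (field m x) = 0" for x
    by (simp add: differential_eq[OF g(2)] field_gradient_orthogonal[OF g(1)])
  then show ?thesis
    unfolding first_integral_def using smooth_integrals[OF assms] by blast
qed

text \<open>Makes the natural number subtraction in \<open>dind\<close> a true one.\<close>

lemma card_I_le: "card I \<le> DIM('v)"
  using dim_range_kernel dim_range_A by linarith

theorem nc_integrable_by_integrals: "nc_integrable_by twisted (energy m) (field m) integrals"
proof -
  have "has_ddim integrals (DIM('v) + card I)"
    unfolding has_ddim_def differential_span_integrals dim_image_blinfun_inner_right
    by (rule generic_mono[OF generic_frame]) (simp add: dim_gradients)
  moreover have "has_dind twisted integrals (DIM('v) - card I)"
    unfolding has_dind_def poisson_kernel_integrals dim_image_blinfun_inner_right
    by (rule generic_mono[OF generic_frame]) (simp add: dim_pairing_kernel)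
  moreover have "(DIM('v) + card I) + (DIM('v) - card I) = DIM('v \<times> 'v)"
    using card_I_le by simp
  ultimately show ?thesis
    unfolding nc_integrable_by_def
    using symplectic_form_twisted hamiltonian_field_energy first_integral_integrals
      poisson_algebra_integrals by blast
qed

end

subsection \<open>Existence of a normal frame\<close>

text \<open>A unit vector \<open>v\<close> maximising \<open>norm (A v)\<close> satisfies \<open>A (A v) = - (norm (A v))\<^sup>2 v\<close>: by skewness
  \<open>- A (A v) \<bullet> v = (norm (A v))\<^sup>2\<close>, and by maximality \<open>norm (A (A v)) \<le> (norm (A v))\<^sup>2\<close>, which is the
  equality case of the Cauchy-Schwarz inequality.\<close>

lemma (in skew_map) exists_plane:
  assumes "A x \<noteq> 0"
  obtains a c \<mu> where "a \<bullet> a = 1" "c \<bullet> c = 1" "a \<bullet> c = 0" "\<mu> \<noteq> 0" "A a = - \<mu> *\<^sub>R c" "A c = \<mu> *\<^sub>R a"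
proof -
  have "x \<noteq> 0" using assms by (auto simp: A_simps)
  have "continuous_on (sphere 0 1) (\<lambda>v. norm (A v))"
    by (intro continuous_on_norm linear_continuous_on linear_conv_bounded_linear[THEN iffD1] linear_A)
  moreover have "sgn x \<in> sphere 0 1"
    using \<open>x \<noteq> 0\<close> by (simp add: norm_sgn)
  ultimately obtain v where "norm v = 1" and max: "\<And>w. norm w = 1 \<Longrightarrow> norm (A w) \<le> norm (A v)"
    using continuous_attains_sup[of "sphere 0 1" "\<lambda>v. norm (A v)"] by (auto simp: dist_norm)
  define \<mu> where "\<mu> = norm (A v)"
  have le: "norm (A w) \<le> \<mu> * norm w" for w
  proof (cases "w = 0")
    case False
    then have "norm (A (sgn w)) \<le> \<mu>"
      unfolding \<mu>_def by (intro max) (simp add: norm_sgn)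
    then show ?thesis
      using False by (simp add: sgn_div_norm A_simps field_simps)
  qed (simp add: A_simps)
  have "\<mu> \<noteq> 0"
    using le[of x] assms by auto
  have "(norm (A (A v)))\<^sup>2 \<le> (\<mu> * \<mu>)\<^sup>2"
    using le[of "A v"] by (simp add: \<mu>_def power_mono)
  moreover have "A (A v) \<bullet> v = - (\<mu> * \<mu>)"
    using skew[of "A v" v] by (simp add: \<mu>_def dot_square_norm power2_eq_square)
  moreover have "v \<bullet> v = 1"
    using \<open>norm v = 1\<close> by (simp add: dot_square_norm)
  moreover have "(norm (A (A v) + (\<mu> * \<mu>) *\<^sub>R v))\<^sup>2 =
      (norm (A (A v)))\<^sup>2 + 2 * (\<mu> * \<mu>) * (A (A v) \<bullet> v) + (\<mu> * \<mu>)\<^sup>2 * (v \<bullet> v)"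
    by (simp only: power2_norm_eq_inner)
      (simp add: algebra_simps inner_commute power2_eq_square)
  ultimately have "(norm (A (A v) + (\<mu> * \<mu>) *\<^sub>R v))\<^sup>2 \<le> 0"
    by (simp add: power2_eq_square)
  then have AA: "A (A v) = - (\<mu> * \<mu>) *\<^sub>R v"
    by (simp add: add_eq_0_iff)
  show thesis
  proof
    show "v \<bullet> v = 1" by fact
    show "\<mu> \<noteq> 0" by fact
    show "(- 1 / \<mu>) *\<^sub>R A v \<bullet> (- 1 / \<mu>) *\<^sub>R A v = 1"
      using \<open>\<mu> \<noteq> 0\<close> by (simp add: dot_square_norm power2_eq_square flip: \<mu>_def)
    show "v \<bullet> (- 1 / \<mu>) *\<^sub>R A v = 0" by simp
    show "A v = - \<mu> *\<^sub>R (- 1 / \<mu>) *\<^sub>R A v" using \<open>\<mu> \<noteq> 0\<close> by simp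
    show "A ((- 1 / \<mu>) *\<^sub>R A v) = \<mu> *\<^sub>R v" using \<open>\<mu> \<noteq> 0\<close> by (simp only: A_simps AA) simp
  qed
qed

text \<open>Induction on the rank. Subtracting the block of one plane leaves a skew map
  \<open>B\<close> that kills \<open>a\<close> and \<open>c\<close>. By skewness its range is
  orthogonal to both, so \<open>a\<close> leaves the range and the rank drops.\<close>

theorem exists_normal_frame:
  fixes A :: "'v::euclidean_space \<Rightarrow> 'v"
  assumes "skew_map A"
  shows "\<exists>(r::nat) a c \<mu>. normal_frame A {..<r} a c \<mu>"
  using assms
proof (induction "dim (range A)" arbitrary: A rule: less_induct)
  case less
  then interpret skew_map A by simp
  show ?case
  proof (cases "\<forall>x. A x = 0")
    case True
    then have "normal_frame A {..<0::nat} (\<lambda>_. 0) (\<lambda>_. 0) (\<lambda>_. 1)"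
      by unfold_locales auto
    then show ?thesis by blast
  next
    case False
    then obtain a c \<mu> where ac: "a \<bullet> a = 1" "c \<bullet> c = 1" "a \<bullet> c = 0" "\<mu> \<noteq> 0"
      and A: "A a = - \<mu> *\<^sub>R c" "A c = \<mu> *\<^sub>R a"
      using exists_plane by metis
    define B where "B w = A w - \<mu> *\<^sub>R ((c \<bullet> w) *\<^sub>R a - (a \<bullet> w) *\<^sub>R c)" for w
    have skew_B: "skew_map B"
    proof (rule skew_map.intro)
      show "linear B"
        by (intro linearI) (auto simp: B_def A_simps algebra_simps)
      show "B x \<bullet> y = - (x \<bullet> B y)" for x y
        using skew[of x y] by (simp add: B_def algebra_simps inner_commute)
    qed
    then interpret B: skew_map B .
    have B0: "B a = 0" "B c = 0"
      using ac by (simp_all add: B_def A inner_commute)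
    have B_orth: "B w \<bullet> a = 0" "B w \<bullet> c = 0" for w
      using B.skew[of w a] B.skew[of w c] by (simp_all add: B0)
    have a: "a = A ((1 / \<mu>) *\<^sub>R c)" and c: "c = A ((- 1 / \<mu>) *\<^sub>R a)"
      using ac(4) by (simp_all only: A_simps A) simp_all
    have sub: "subspace (range A)" "subspace (range B)"
      using linear_A B.linear_A by (simp_all add: linear_subspace_image)
    have "a \<in> range A" "c \<in> range A"
      using a c by blast+
    then have "range B \<subseteq> range A"
      using sub(1) unfolding B_def by (auto intro!: subspace_diff subspace_scale)
    moreover have "a \<notin> range B"
      using B_orth(1) ac(1) by force
    ultimately have "span (range B) \<subset> span (range A)"
      using \<open>a \<in> range A\<close> sub by (auto simp: span_eq_iff[THEN iffD2])
    then have "dim (range B) < dim (range A)"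
      by (rule dim_psubset)
    then obtain r :: nat and a' c' \<mu>' where "normal_frame B {..<r} a' c' \<mu>'"
      using less.hyps skew_B by blast
    then interpret B: normal_frame B "{..<r}" a' c' \<mu>' .
    \<comment> \<open>The frame found for \<open>B\<close> lies in the range of \<open>B\<close>,
      hence is orthogonal to the plane already split off.\<close>
    have "a' i = B ((1 / \<mu>' i) *\<^sub>R c' i)" "c' i = B ((- 1 / \<mu>' i) *\<^sub>R a' i)" if "i < r" for i
      using that B.\<mu>_nonzero[of i] by (simp_all only: B.A_simps B.A_frame lessThan_iff) simp_all
    then have orth: "a' i \<bullet> a = 0" "a' i \<bullet> c = 0" "c' i \<bullet> a = 0" "c' i \<bullet> c = 0" if "i < r" for i
      using B_orth that by metis+
    have "normal_frame A {..<Suc r} (a'(r := a)) (c'(r := c)) (\<mu>'(r := \<mu>))"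
    proof
      fix w
      have "A w = B w + \<mu> *\<^sub>R ((c \<bullet> w) *\<^sub>R a - (a \<bullet> w) *\<^sub>R c)"
        by (simp add: B_def)
      then show "A w = (\<Sum>i<Suc r. (\<mu>'(r := \<mu>)) i *\<^sub>R
          (((c'(r := c)) i \<bullet> w) *\<^sub>R (a'(r := a)) i - ((a'(r := a)) i \<bullet> w) *\<^sub>R (c'(r := c)) i))"
        by (simp add: B.A_eq)
    qed (use ac orth B.inner_aa B.inner_cc B.inner_ac B.\<mu>_nonzero in
        \<open>auto simp: less_Suc_eq inner_commute\<close>)
    then show ?thesis by blast
  qed
qed

subsection \<open>Quasi-periodic motion\<close>

text \<open>The field is linear, so the difference of two solutions is a solution starting at zero.
  Skewness conserves the norm of its momentum, which therefore stays zero, and then its position is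
  constant.\<close>

lemma (in skew_map) integral_curve_unique:
  assumes "integral_curve (field m) c" "integral_curve (field m) d" "c 0 = d 0"
  shows "c = d"
proof -
  define \<delta> where "\<delta> t = c t - d t" for t
  have \<delta>: "(\<delta> has_vector_derivative field m (\<delta> t)) (at t)" for t
  proof -
    have "(\<delta> has_vector_derivative field m (c t) - field m (d t)) (at t)"
      unfolding \<delta>_def[abs_def]
      using assms(1,2) by (intro has_vector_derivative_diff) (auto simp: integral_curve_def)
    then show ?thesis
      by (simp add: \<delta>_def field_def A_simps scaleR_diff_right)
  qed
  have fst: "((\<lambda>t. fst (\<delta> t)) has_vector_derivative (1 / m) *\<^sub>R snd (\<delta> t)) (at t)"
    and snd: "((\<lambda>t. snd (\<delta> t)) has_vector_derivative (1 / m) *\<^sub>R A (snd (\<delta> t))) (at t)" for t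
    using bounded_linear.has_vector_derivative[OF bounded_linear_fst \<delta>[of t]]
      bounded_linear.has_vector_derivative[OF bounded_linear_snd \<delta>[of t]]
    by (simp_all add: field_def)
  have "((\<lambda>t. snd (\<delta> t) \<bullet> snd (\<delta> t)) has_derivative (\<lambda>h. 0)) (at t)" for t
    using has_derivative_inner[OF snd[of t, unfolded has_vector_derivative_def]
        snd[of t, unfolded has_vector_derivative_def]] by simp
  then have "snd (\<delta> t) \<bullet> snd (\<delta> t) = snd (\<delta> 0) \<bullet> snd (\<delta> 0)" for t
    using has_derivative_zero_unique[of UNIV "\<lambda>t. snd (\<delta> t) \<bullet> snd (\<delta> t)" t 0] by simp
  then have snd0: "snd (\<delta> t) = 0" for t
    using assms(3) by (simp add: \<delta>_def)
  then have "((\<lambda>t. fst (\<delta> t)) has_derivative (\<lambda>h. 0)) (at t)" for t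
    using fst[of t] by (simp add: has_vector_derivative_def)
  then have "fst (\<delta> t) = fst (\<delta> 0)" for t
    using has_derivative_zero_unique[of UNIV "\<lambda>t. fst (\<delta> t)" t 0] by simp
  then have "\<delta> t = 0" for t
    using snd0[of t] assms(3) by (simp add: \<delta>_def prod_eq_iff)
  then show ?thesis by (auto simp: \<delta>_def)
qed

lemma level_set_generated_algebra:
  "{y. \<forall>f\<in>generated_algebra G. f y = f x} = {y. \<forall>f\<in>G. f y = f x}"
proof -
  have "f y = f x" if "f \<in> generated_algebra G" "\<forall>f\<in>G. f y = f x" for f y
    using that by (induction rule: generated_algebra.induct) auto
  then show ?thesis
    using generated_algebra.generator by blast
qed

lemma exists_rotation_angle:
  fixes p q p' q' :: real
  assumes "p'\<^sup>2 + q'\<^sup>2 = p\<^sup>2 + q\<^sup>2" "p\<^sup>2 + q\<^sup>2 \<noteq> 0"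
  shows "\<exists>t. p' = cos t * p + sin t * q \<and> q' = cos t * q - sin t * p"
proof -
  let ?r = "p\<^sup>2 + q\<^sup>2"
  \<comment> \<open>Normalised inner and cross product of the two vectors, that is, cosine and sine
    of the angle between them.\<close>
  let ?C = "(p * p' + q * q') / ?r" and ?S = "(q * p' - p * q') / ?r"
  have "(p * p' + q * q')\<^sup>2 + (q * p' - p * q')\<^sup>2 = ?r * (p'\<^sup>2 + q'\<^sup>2)"
    by algebra
  then have "?C\<^sup>2 + ?S\<^sup>2 = 1"
    using assms by (simp add: power_divide power2_eq_square flip: add_divide_distrib)
  then obtain t where t: "?C = cos t" "?S = sin t"
    using sincos_total_2pi by metis
  have "?C * p + ?S * q = p' * ?r / ?r" "?C * q - ?S * p = q' * ?r / ?r"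
    by (simp_all add: power2_eq_square algebra_simps flip: add_divide_distrib diff_divide_distrib)
  then show ?thesis
    using assms(2) t by (intro exI[of _ t]) auto
qed

text \<open>The indices in \<open>J\<close> number the planes and those outside \<open>J\<close> the
  kernel directions, matching the periodic and free coordinates in
  \<open>quasi_periodic_over\<close>. \<open>expansion\<close> says that together they exhaust the
  space.\<close>

locale complete_frame = normal_frame A J a c \<mu>
  for A :: "'v::euclidean_space \<Rightarrow> 'v" and J :: "'k::finite set"
    and a c :: "'k \<Rightarrow> 'v" and \<mu> :: "'k \<Rightarrow> real" +
  fixes e :: "'k \<Rightarrow> 'v"
  assumes inner_ee: "j \<notin> J \<Longrightarrow> k \<notin> J \<Longrightarrow> e j \<bullet> e k = (if j = k then 1 else 0)"
    and inner_ea: "j \<notin> J \<Longrightarrow> i \<in> J \<Longrightarrow> e j \<bullet> a i = 0"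
    and inner_ec: "j \<notin> J \<Longrightarrow> i \<in> J \<Longrightarrow> e j \<bullet> c i = 0"
    and expansion: "w = (\<Sum>i\<in>J. P i w) + (\<Sum>i\<in>-J. (e i \<bullet> w) *\<^sub>R e i)"
begin

section \<open>The orbit map and the level sets of the integrals\<close>

lemma inner_ae: "j \<notin> J \<Longrightarrow> i \<in> J \<Longrightarrow> a i \<bullet> e j = 0"
  and inner_ce: "j \<notin> J \<Longrightarrow> i \<in> J \<Longrightarrow> c i \<bullet> e j = 0"
  using inner_ea inner_ec by (simp_all add: inner_commute)

lemma A_e: "j \<notin> J \<Longrightarrow> A (e j) = 0"
  unfolding A_eq by (intro sum.neutral) (simp add: inner_ae inner_ce)

lemma inner_e_A: "j \<notin> J \<Longrightarrow> e j \<bullet> A w = 0"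
  using skew[of "e j" w] by (simp add: A_e)

lemma kernel_A: "A z = 0 \<Longrightarrow> i \<in> J \<Longrightarrow> P i z = 0"
  using skew[of "a i" z] skew[of "c i" z] \<mu>_nonzero[of i] by (simp add: A_frame P_def)

lemma inner_e_P: "j \<notin> J \<Longrightarrow> i \<in> J \<Longrightarrow> e j \<bullet> P i w = 0"
  and inner_e_Q: "j \<notin> J \<Longrightarrow> i \<in> J \<Longrightarrow> e j \<bullet> Q i w = 0"
  by (simp_all add: P_def Q_def inner_add_right inner_diff_right inner_ea inner_ec)

text \<open>The momentum in plane \<open>j\<close> turned by the angle \<open>\<theta> $ j\<close>;
  \<open>rot'\<close> is its derivative in that angle.\<close>

definition rot :: "'v \<times> 'v \<Rightarrow> real ^ 'k \<Rightarrow> 'k \<Rightarrow> 'v" where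
  "rot x \<theta> j = cos (\<theta> $ j) *\<^sub>R P j (snd x) + sin (\<theta> $ j) *\<^sub>R Q j (snd x)"

definition rot' :: "'v \<times> 'v \<Rightarrow> real ^ 'k \<Rightarrow> 'k \<Rightarrow> 'v" where
  "rot' x \<theta> j = cos (\<theta> $ j) *\<^sub>R Q j (snd x) - sin (\<theta> $ j) *\<^sub>R P j (snd x)"

text \<open>In each plane the momentum turns on a circle and the position on a circle of radius
  \<open>1 / \<bar>\<mu> j\<bar>\<close> times that of the momentum, about a fixed centre. In the kernel of \<open>A\<close> the position is
  free and the momentum constant.\<close>

definition orbit_map :: "'v \<times> 'v \<Rightarrow> real ^ 'k \<Rightarrow> 'v \<times> 'v" where
  "orbit_map x \<theta> = x + (\<Sum>j\<in>-J. (\<theta> $ j) *\<^sub>R (e j, 0)) +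
    (\<Sum>j\<in>J. sin (\<theta> $ j) *\<^sub>R ((1 / \<mu> j) *\<^sub>R P j (snd x), Q j (snd x)) +
       (1 + (- 1) * cos (\<theta> $ j)) *\<^sub>R ((1 / \<mu> j) *\<^sub>R Q j (snd x), - P j (snd x)))"

definition orbit_derivative :: "'v \<times> 'v \<Rightarrow> real ^ 'k \<Rightarrow> real ^ 'k \<Rightarrow> 'v \<times> 'v" where
  "orbit_derivative x \<theta> h = (\<Sum>j\<in>-J. (h $ j) *\<^sub>R (e j, 0)) +
    (\<Sum>j\<in>J. (h $ j) *\<^sub>R ((1 / \<mu> j) *\<^sub>R rot x \<theta> j, rot' x \<theta> j))"

lemma A_rot: "j \<in> J \<Longrightarrow> A (rot x \<theta> j) = \<mu> j *\<^sub>R rot' x \<theta> j"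
  by (simp add: rot_def rot'_def A_simps A_P A_Q algebra_simps)

lemma inner_rot: "i \<in> J \<Longrightarrow> j \<in> J \<Longrightarrow>
    rot x \<theta> i \<bullet> rot x \<eta> j = (if i = j then action i x * cos (\<eta> $ i - \<theta> $ i) else 0)"
  and inner_rot'_rot: "i \<in> J \<Longrightarrow> j \<in> J \<Longrightarrow>
    rot' x \<theta> i \<bullet> rot x \<eta> j = (if i = j then action i x * sin (\<eta> $ i - \<theta> $ i) else 0)"
  by (auto simp: rot_def rot'_def algebra_simps inner_PP inner_QQ inner_PQ
      inner_commute[of "Q _ _" "P _ _"] action_def sin_diff cos_diff)

lemma inner_e_rot: "j \<notin> J \<Longrightarrow> i \<in> J \<Longrightarrow> e j \<bullet> rot x \<theta> i = 0"
  and inner_e_rot': "j \<notin> J \<Longrightarrow> i \<in> J \<Longrightarrow> e j \<bullet> rot' x \<theta> i = 0"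
  by (simp_all add: rot_def rot'_def inner_e_P inner_e_Q inner_add_right inner_diff_right)

lemma fst_orbit_map: "fst (orbit_map x \<theta>) = fst x + (\<Sum>j\<in>-J. (\<theta> $ j) *\<^sub>R e j) +
    (\<Sum>j\<in>J. (1 / \<mu> j) *\<^sub>R (sin (\<theta> $ j) *\<^sub>R P j (snd x) + (1 - cos (\<theta> $ j)) *\<^sub>R Q j (snd x)))"
  by (auto simp: orbit_map_def fst_sum algebra_simps intro!: sum.cong)

lemma snd_orbit_map_diff: "snd (orbit_map x \<theta>) = snd x + (\<Sum>j\<in>J. rot x \<theta> j - P j (snd x))"
  by (auto simp: orbit_map_def rot_def snd_sum algebra_simps intro!: sum.cong)

lemma snd_orbit_map:
  "snd (orbit_map x \<theta>) = (\<Sum>j\<in>J. rot x \<theta> j) + (\<Sum>j\<in>-J. (e j \<bullet> snd x) *\<^sub>R e j)"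
  using expansion[of "snd x"] by (simp add: snd_orbit_map_diff sum_subtractf algebra_simps)

lemma inner_e_fst_orbit_map:
  assumes "k \<notin> J"
  shows "e k \<bullet> fst (orbit_map x \<theta>) = e k \<bullet> fst x + \<theta> $ k"
proof -
  have "(\<Sum>j\<in>-J. \<theta> $ j * (e k \<bullet> e j)) = (\<Sum>j\<in>-J. if j = k then \<theta> $ k else 0)"
    using assms by (intro sum.cong) (auto simp: inner_ee)
  then show ?thesis
    using assms by (simp add: fst_orbit_map inner_add_right inner_sum_right inner_e_P inner_e_Q)
qed

text \<open>Reads angle differences off a point of the orbit: with base angle zero for
  \<open>orbit_map_eq_iff\<close>, with a nearby base angle for
  \<open>open_map_orbit_map\<close>.\<close>

lemma inner_snd_orbit_map:
  assumes "i \<in> J"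
  shows "rot x \<theta> i \<bullet> snd (orbit_map x \<eta>) = action i x * cos (\<eta> $ i - \<theta> $ i)"
    and "rot' x \<theta> i \<bullet> snd (orbit_map x \<eta>) = action i x * sin (\<eta> $ i - \<theta> $ i)"
  using assms
  by (simp_all add: snd_orbit_map inner_add_right inner_sum_right inner_rot inner_rot'_rot
      inner_e_rot inner_e_rot' inner_commute[of _ "e _"])

lemma P_snd_orbit_map:
  assumes "i \<in> J"
  shows "P i (snd (orbit_map x \<theta>)) = rot x \<theta> i"
proof -
  have a: "a i \<bullet> rot x \<theta> j = (if j = i then a i \<bullet> rot x \<theta> i else 0)"
    and c: "c i \<bullet> rot x \<theta> j = (if j = i then c i \<bullet> rot x \<theta> i else 0)" if "j \<in> J" for j
    using assms that
    by (auto simp: rot_def P_def Q_def inner_add_right inner_diff_right inner_aa inner_cc inner_ac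
        inner_ca)
  have "(\<Sum>j\<in>J. a i \<bullet> rot x \<theta> j) = (\<Sum>j\<in>J. if j = i then a i \<bullet> rot x \<theta> i else 0)"
    by (intro sum.cong refl a)
  then have "a i \<bullet> snd (orbit_map x \<theta>) = a i \<bullet> rot x \<theta> i"
    using assms by (simp add: snd_orbit_map inner_add_right inner_sum_right inner_ae)
  moreover have "(\<Sum>j\<in>J. c i \<bullet> rot x \<theta> j) = (\<Sum>j\<in>J. if j = i then c i \<bullet> rot x \<theta> i else 0)"
    by (intro sum.cong refl c)
  then have "c i \<bullet> snd (orbit_map x \<theta>) = c i \<bullet> rot x \<theta> i"
    using assms by (simp add: snd_orbit_map inner_add_right inner_sum_right inner_ce)
  ultimately have "P i (snd (orbit_map x \<theta>)) = P i (rot x \<theta> i)"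
    by (simp add: P_def)
  also have "\<dots> = rot x \<theta> i"
    using assms by (simp add: rot_def P_def Q_def algebra_simps inner_aa inner_cc inner_ac inner_ca)
  finally show ?thesis .
qed

lemma action_eq: "i \<in> J \<Longrightarrow> action i x = P i (snd x) \<bullet> P i (snd x)"
  by (simp add: action_def inner_PP)

lemma momentum_eq: "momentum f x = (snd x - A (fst x)) \<bullet> f"
  by (simp add: momentum_def inner_diff_left skew)

lemma A_fst_orbit_map: "snd (orbit_map x \<theta>) - A (fst (orbit_map x \<theta>)) = snd x - A (fst x)"
proof -
  have "A (fst (orbit_map x \<theta>)) = A (fst x) + (\<Sum>j\<in>-J. A ((\<theta> $ j) *\<^sub>R e j)) +
      (\<Sum>j\<in>J. A ((1 / \<mu> j) *\<^sub>R (sin (\<theta> $ j) *\<^sub>R P j (snd x) + (1 - cos (\<theta> $ j)) *\<^sub>R Q j (snd x))))"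
    by (simp only: fst_orbit_map A_simps linear_sum[OF linear_A])
  also have "(\<Sum>j\<in>-J. A ((\<theta> $ j) *\<^sub>R e j)) = 0"
    by (intro sum.neutral) (simp add: A_simps A_e)
  also have "(\<Sum>j\<in>J. A ((1 / \<mu> j) *\<^sub>R (sin (\<theta> $ j) *\<^sub>R P j (snd x) + (1 - cos (\<theta> $ j)) *\<^sub>R Q j (snd x)))) =
      (\<Sum>j\<in>J. rot x \<theta> j - P j (snd x))"
    using \<mu>_nonzero
    by (intro sum.cong refl) (simp only: A_simps A_P A_Q, simp add: rot_def algebra_simps)
  finally show ?thesis
    by (simp add: snd_orbit_map_diff)
qed

lemma level_set_integrals:
  assumes generic: "\<And>i. i \<in> J \<Longrightarrow> action i x \<noteq> 0"
  shows "{y. \<forall>f\<in>integrals. f y = f x} = range (orbit_map x)"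
proof -
  have "(\<forall>f. momentum f y = momentum f x) \<longleftrightarrow> snd y - A (fst y) = snd x - A (fst x)" for y
    by (simp only: momentum_eq vector_eq_rdot)
  then have "{y. \<forall>f\<in>integrals. f y = f x} =
      {y. snd y - A (fst y) = snd x - A (fst x) \<and> (\<forall>i\<in>J. action i y = action i x)}"
    unfolding integrals_def level_set_generated_algebra
    by (simp add: ball_Un)
  also have "\<dots> = range (orbit_map x)"
  proof (intro equalityI subsetI)
    fix y assume "y \<in> range (orbit_map x)"
    then show "y \<in> {y. snd y - A (fst y) = snd x - A (fst x) \<and> (\<forall>i\<in>J. action i y = action i x)}"
      by (auto simp: A_fst_orbit_map action_eq P_snd_orbit_map inner_rot)
  next
    fix y assume "y \<in> {y. snd y - A (fst y) = snd x - A (fst x) \<and> (\<forall>i\<in>J. action i y = action i x)}"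
    then have momentum: "snd y - A (fst y) = snd x - A (fst x)"
      and action: "\<And>i. i \<in> J \<Longrightarrow> action i y = action i x"
      by auto
    have "\<exists>t. a i \<bullet> snd y = cos t * (a i \<bullet> snd x) + sin t * (c i \<bullet> snd x) \<and>
        c i \<bullet> snd y = cos t * (c i \<bullet> snd x) - sin t * (a i \<bullet> snd x)" if "i \<in> J" for i
      using action[OF that] generic[OF that] unfolding action_def by (rule exists_rotation_angle)
    then obtain t where t: "\<And>i. i \<in> J \<Longrightarrow> a i \<bullet> snd y = cos (t i) * (a i \<bullet> snd x) + sin (t i) * (c i \<bullet> snd x)"
        "\<And>i. i \<in> J \<Longrightarrow> c i \<bullet> snd y = cos (t i) * (c i \<bullet> snd x) - sin (t i) * (a i \<bullet> snd x)"
      by metis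
    define \<theta> where "\<theta> = (\<chi> k. if k \<in> J then t k else e k \<bullet> (fst y - fst x))"
    have "P i (snd y) = rot x \<theta> i" if "i \<in> J" for i
      using that by (simp add: rot_def P_def Q_def t \<theta>_def algebra_simps)
    \<comment> \<open>A kernel component of the momentum is itself a conserved momentum, since
      \<open>A\<close> has no component along \<open>e k\<close>.\<close>
    moreover have "e k \<bullet> snd y = e k \<bullet> snd x" if "k \<notin> J" for k
      using arg_cong[OF momentum, of "inner (e k)"] that by (simp add: inner_diff_right inner_e_A)
    ultimately have snd: "snd y = snd (orbit_map x \<theta>)"
      by (subst expansion) (simp add: snd_orbit_map cong: sum.cong_simp)
    \<comment> \<open>With equal momenta and equal magnetic momenta, the position error
      \<open>z\<close> lies in the kernel of \<open>A\<close>; its kernel components vanish by the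
      choice of \<open>\<theta>\<close> outside \<open>J\<close>.\<close>
    define z where "z = fst y - fst (orbit_map x \<theta>)"
    have "A z = (snd y - (snd y - A (fst y))) -
        (snd (orbit_map x \<theta>) - (snd (orbit_map x \<theta>) - A (fst (orbit_map x \<theta>))))"
      by (simp add: z_def A_simps)
    then have "A z = 0"
      unfolding momentum A_fst_orbit_map unfolding snd by simp
    then have "P i z = 0" if "i \<in> J" for i
      using that by (rule kernel_A)
    moreover have "e k \<bullet> z = 0" if "k \<notin> J" for k
      using that by (simp add: z_def inner_diff_right inner_e_fst_orbit_map \<theta>_def)
    ultimately have "z = 0"
      using expansion[of z] by simp
    then have "y = orbit_map x \<theta>"
      using snd by (simp add: z_def prod_eq_iff)
    then show "y \<in> range (orbit_map x)" by blast
  qed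
  finally show ?thesis .
qed

text \<open>The coefficient \<open>1 + (- 1) * cos (\<theta> $ j)\<close> in
  \<open>orbit_map\<close> is spelled so that the rules for sums, products and constants match
  it.\<close>

lemma smooth_orbit_map: "smooth (orbit_map x)"
  unfolding orbit_map_def
  by (intro smooth_add smooth_sum smooth_scaleR smooth_const smooth_mult smooth_sin_cos
      smooth_bounded_linear bounded_linear_vec_nth)

section \<open>Tangent vectors, isotropy and immersion\<close>

lemma orbit_map_derivative: "(orbit_map x has_derivative orbit_derivative x \<theta>) (at \<theta>)"
proof -
  note [derivative_intros] = bounded_linear_imp_has_derivative[OF bounded_linear_vec_nth]
  show ?thesis
    unfolding orbit_map_def
    by (rule derivative_eq_intros refl)+
      (auto simp: fun_eq_iff orbit_derivative_def rot_def rot'_def algebra_simps intro!: sum.cong)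
qed

lemma frechet_derivative_orbit_map: "frechet_derivative (orbit_map x) (at \<theta>) = orbit_derivative x \<theta>"
  using frechet_derivative_at[OF orbit_map_derivative] by simp

text \<open>Tangent vectors are \<open>(z + y, A y)\<close> with \<open>z\<close> in the kernel of
  \<open>A\<close>: this is conservation of the magnetic momentum at the infinitesimal
  level.\<close>

lemma orbit_derivative_eq:
  obtains y where "fst (orbit_derivative x \<theta> h) = (\<Sum>j\<in>-J. (h $ j) *\<^sub>R e j) + y"
    and "snd (orbit_derivative x \<theta> h) = A y" and "y = (\<Sum>j\<in>J. (h $ j / \<mu> j) *\<^sub>R rot x \<theta> j)"
proof
  show "fst (orbit_derivative x \<theta> h) =
      (\<Sum>j\<in>-J. (h $ j) *\<^sub>R e j) + (\<Sum>j\<in>J. (h $ j / \<mu> j) *\<^sub>R rot x \<theta> j)"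
    by (simp add: orbit_derivative_def fst_sum)
  show "snd (orbit_derivative x \<theta> h) = A (\<Sum>j\<in>J. (h $ j / \<mu> j) *\<^sub>R rot x \<theta> j)"
    using \<mu>_nonzero
    by (simp add: orbit_derivative_def snd_sum linear_sum[OF linear_A] A_simps A_rot cong: sum.cong)
qed (rule refl)

lemma inner_rot_A_rot: "i \<in> J \<Longrightarrow> j \<in> J \<Longrightarrow> rot x \<theta> i \<bullet> A (rot x \<theta> j) = 0"
  by (auto simp: A_rot inner_commute[of _ "rot' _ _ _"] inner_rot'_rot)

text \<open>For tangent vectors in the form of \<open>orbit_derivative_eq\<close> all kernel terms
  drop out and the form reduces, up to sign, to \<open>y \<bullet> A z\<close>, which vanishes by
  \<open>inner_rot_A_rot\<close>.\<close>

lemma isotropic_orbit_map: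
  "twisted (orbit_derivative x \<theta> u) (orbit_derivative x \<theta> v) = 0"
proof -
  obtain y where y: "fst (orbit_derivative x \<theta> u) = (\<Sum>j\<in>-J. (u $ j) *\<^sub>R e j) + y"
    "snd (orbit_derivative x \<theta> u) = A y" and y_eq: "y = (\<Sum>j\<in>J. (u $ j / \<mu> j) *\<^sub>R rot x \<theta> j)"
    by (rule orbit_derivative_eq)
  obtain z where z: "fst (orbit_derivative x \<theta> v) = (\<Sum>j\<in>-J. (v $ j) *\<^sub>R e j) + z"
    "snd (orbit_derivative x \<theta> v) = A z" and z_eq: "z = (\<Sum>j\<in>J. (v $ j / \<mu> j) *\<^sub>R rot x \<theta> j)"
    by (rule orbit_derivative_eq)
  have ker: "A (\<Sum>j\<in>-J. (w $ j) *\<^sub>R e j) = 0" for w :: "real ^ 'k"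
    by (simp add: linear_sum[OF linear_A] A_simps A_e)
  have "y \<bullet> A z = 0"
    by (simp add: y_eq z_eq linear_sum[OF linear_A] A_simps inner_sum_left inner_sum_right inner_rot_A_rot)
  then show ?thesis
    using skew[of y z] skew[of y "\<Sum>j\<in>-J. (v $ j) *\<^sub>R e j"] skew[of z "\<Sum>j\<in>-J. (u $ j) *\<^sub>R e j"]
      skew[of "\<Sum>j\<in>-J. (u $ j) *\<^sub>R e j" z]
    by (simp add: twisted_def y z A_simps ker inner_add_left inner_add_right inner_commute)
qed

text \<open>The position component alone determines \<open>h\<close>: the vectors \<open>e j\<close>
  and \<open>rot x \<theta> i\<close> are orthogonal, with squared norms \<open>1\<close> and
  \<open>action i x\<close>.\<close>

lemma inj_orbit_derivative:
  assumes generic: "\<And>i. i \<in> J \<Longrightarrow> action i x \<noteq> 0"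
  shows "inj (orbit_derivative x \<theta>)"
proof -
  have "h = 0" if "orbit_derivative x \<theta> h = 0" for h
  proof -
    obtain y where y: "fst (orbit_derivative x \<theta> h) = (\<Sum>j\<in>-J. (h $ j) *\<^sub>R e j) + y"
      and y_eq: "y = (\<Sum>j\<in>J. (h $ j / \<mu> j) *\<^sub>R rot x \<theta> j)"
      by (rule orbit_derivative_eq)
    then have 0: "(\<Sum>j\<in>-J. (h $ j) *\<^sub>R e j) + y = 0"
      using that by simp
    have "h $ i = 0" for i
    proof (cases "i \<in> J")
      case True
      have "0 = rot x \<theta> i \<bullet> ((\<Sum>j\<in>-J. (h $ j) *\<^sub>R e j) + y)"
        by (simp only: 0 inner_zero_right)
      also have "\<dots> = (\<Sum>j\<in>J. h $ j / \<mu> j * (rot x \<theta> i \<bullet> rot x \<theta> j))"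
        using True
        by (simp add: y_eq inner_add_right inner_sum_right inner_commute[of _ "e _"] inner_e_rot)
      also have "\<dots> = (\<Sum>j\<in>J. if j = i then h $ i / \<mu> i * action i x else 0)"
        using True by (intro sum.cong) (auto simp: inner_rot)
      finally show ?thesis
        using True generic \<mu>_nonzero by simp
    next
      case False
      have "0 = e i \<bullet> ((\<Sum>j\<in>-J. (h $ j) *\<^sub>R e j) + y)"
        by (simp only: 0 inner_zero_right)
      also have "\<dots> = (\<Sum>j\<in>-J. h $ j * (e i \<bullet> e j))"
        using False by (simp add: y_eq inner_add_right inner_sum_right inner_e_rot)
      also have "\<dots> = (\<Sum>j\<in>-J. if j = i then h $ i else 0)"
        using False by (intro sum.cong) (auto simp: inner_ee)
      finally show ?thesis
        using False by simp
    qed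
    then show ?thesis by (simp add: vec_eq_iff)
  qed
  then show ?thesis
    using linear_injective_0 has_derivative_linear[OF orbit_map_derivative] by blast
qed

section \<open>Injectivity up to periods, and openness\<close>

lemma orbit_map_cong:
  assumes "\<And>j. j \<in> J \<Longrightarrow> sin (\<theta> $ j) = sin (\<eta> $ j) \<and> cos (\<theta> $ j) = cos (\<eta> $ j)"
    and "\<And>j. j \<notin> J \<Longrightarrow> \<theta> $ j = \<eta> $ j"
  shows "orbit_map x \<theta> = orbit_map x \<eta>"
  using assms by (simp add: orbit_map_def cong: sum.cong_simp)

lemma orbit_map_eq_iff:
  assumes generic: "\<And>i. i \<in> J \<Longrightarrow> action i x \<noteq> 0"
  shows "orbit_map x \<theta> = orbit_map x \<eta> \<longleftrightarrow>
    (\<forall>j\<in>J. \<exists>z::int. \<theta> $ j - \<eta> $ j = 2 * pi * of_int z) \<and> (\<forall>j\<in>-J. \<theta> $ j = \<eta> $ j)"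
proof -
  have "orbit_map x \<theta> = orbit_map x \<eta> \<longleftrightarrow>
      (\<forall>j\<in>J. sin (\<theta> $ j) = sin (\<eta> $ j) \<and> cos (\<theta> $ j) = cos (\<eta> $ j)) \<and> (\<forall>j\<in>-J. \<theta> $ j = \<eta> $ j)"
  proof (intro iffI conjI ballI)
    assume eq: "orbit_map x \<theta> = orbit_map x \<eta>"
    show "cos (\<theta> $ j) = cos (\<eta> $ j)" if "j \<in> J" for j
      using inner_snd_orbit_map(1)[OF that, of x 0] eq generic[OF that] by (metis mult_cancel_left diff_0_right zero_index)
    show "sin (\<theta> $ j) = sin (\<eta> $ j)" if "j \<in> J" for j
      using inner_snd_orbit_map(2)[OF that, of x 0] eq generic[OF that] by (metis mult_cancel_left diff_0_right zero_index)
    show "\<theta> $ j = \<eta> $ j" if "j \<in> -J" for j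
      using inner_e_fst_orbit_map[of j x] that eq by (metis ComplD add_left_cancel)
  next
    assume "(\<forall>j\<in>J. sin (\<theta> $ j) = sin (\<eta> $ j) \<and> cos (\<theta> $ j) = cos (\<eta> $ j)) \<and> (\<forall>j\<in>-J. \<theta> $ j = \<eta> $ j)"
    then show "orbit_map x \<theta> = orbit_map x \<eta>"
      by (intro orbit_map_cong) auto
  qed
  moreover have "(sin (\<theta> $ j) = sin (\<eta> $ j) \<and> cos (\<theta> $ j) = cos (\<eta> $ j)) \<longleftrightarrow>
      (\<exists>z::int. \<theta> $ j - \<eta> $ j = 2 * pi * of_int z)" for j
    unfolding sin_cos_eq_iff by (auto simp: algebra_simps)
  ultimately show ?thesis by simp
qed

lemma orbit_map_0: "orbit_map x 0 = x"
  by (simp add: orbit_map_def flip: zero_prod_def)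

lemma continuous_on_orbit_map: "continuous_on S (orbit_map x)"
  by (intro continuous_at_imp_continuous_on ballI has_derivative_continuous[OF orbit_map_derivative])

text \<open>Near \<open>orbit_map x \<theta>\<close> the angles are recovered continuously from the point by \<open>arctan\<close>, so
  the parametrisation is open onto its image.\<close>

lemma open_map_orbit_map:
  assumes generic: "\<And>i. i \<in> J \<Longrightarrow> action i x \<noteq> 0"
  shows "open_map euclidean (top_of_set (range (orbit_map x))) (orbit_map x)"
  unfolding open_map_def
proof (intro allI impI)
  fix U :: "(real ^ 'k) set"
  assume "openin euclidean U"
  then have "open U" by simp
  have pos: "action i x > 0" if "i \<in> J" for i
    using generic[OF that] by (simp add: action_def sum_power2_gt_zero_iff)
  have "\<exists>T. openin (top_of_set (range (orbit_map x))) T \<and> orbit_map x \<theta> \<in> T \<and> T \<subseteq> orbit_map x ` U"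
    if "\<theta> \<in> U" for \<theta>
  proof -
    \<comment> \<open>On the orbit, \<open>W\<close> says that every angle differs from that of
      \<open>\<theta>\<close> by an amount with positive cosine, so the quotient under
      \<open>arctan\<close> is defined.\<close>
    define W where "W = {y :: 'v \<times> 'v. \<forall>i\<in>J. rot x \<theta> i \<bullet> snd y > 0}"
    define g where "g y = (\<chi> k. if k \<in> J
        then \<theta> $ k + arctan ((rot' x \<theta> k \<bullet> snd y) / (rot x \<theta> k \<bullet> snd y))
        else e k \<bullet> (fst y - fst x))" for y :: "'v \<times> 'v"
    have "W = (\<Inter>i\<in>J. {y. rot x \<theta> i \<bullet> snd y > 0})"
      by (auto simp: W_def)
    then have "open W"
      by (auto intro!: open_INT open_Collect_less continuous_intros)
    moreover have "continuous_on W g"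
      unfolding g_def
    proof (intro continuous_on_vec_lambda)
      fix k
      show "continuous_on W (\<lambda>y. if k \<in> J
        then \<theta> $ k + arctan ((rot' x \<theta> k \<bullet> snd y) / (rot x \<theta> k \<bullet> snd y)) else e k \<bullet> (fst y - fst x))"
        by (cases "k \<in> J") (auto simp: W_def intro!: continuous_intros)
    qed
    ultimately have "open (W \<inter> g -` U)"
      using \<open>open U\<close> by (intro continuous_open_preimage)
    moreover have "g (orbit_map x \<theta>) = \<theta>"
      by (auto simp: g_def vec_eq_iff inner_snd_orbit_map inner_e_fst_orbit_map inner_diff_right)
    then have "orbit_map x \<theta> \<in> W \<inter> g -` U"
      using that pos by (auto simp: W_def inner_snd_orbit_map)
    moreover have inverse: "orbit_map x (g y) = y" if y: "y \<in> range (orbit_map x)" "y \<in> W" for y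
    proof -
      obtain \<eta> where \<eta>: "y = orbit_map x \<eta>" using y(1) by blast
      have *: "g y $ k = \<eta> $ k" if "k \<notin> J" for k
        using that by (simp add: g_def \<eta> inner_e_fst_orbit_map inner_diff_right)
      \<comment> \<open>\<open>arctan (tan ?d)\<close> recovers \<open>?d\<close> only modulo
        \<open>2 * pi\<close>, so sine and cosine are compared instead;
        \<open>orbit_map_cong\<close> asks for no more.\<close>
      have "sin (g y $ k) = sin (\<eta> $ k) \<and> cos (g y $ k) = cos (\<eta> $ k)" if "k \<in> J" for k
      proof -
        let ?d = "\<eta> $ k - \<theta> $ k"
        have "cos ?d > 0"
          using y(2) that pos[OF that] by (auto simp: W_def \<eta> inner_snd_orbit_map zero_less_mult_iff)
        have "g y $ k = \<theta> $ k + arctan (tan ?d)"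
          using that generic[OF that] by (simp add: g_def \<eta> inner_snd_orbit_map tan_def)
        moreover have "cos (arctan (tan ?d)) = cos ?d"
        proof -
          have "1 + (tan ?d)\<^sup>2 = (inverse (cos ?d))\<^sup>2"
            using \<open>cos ?d > 0\<close> by (subst tan_sec) auto
          then have "cos (arctan (tan ?d)) = 1 / \<bar>inverse (cos ?d)\<bar>"
            by (simp add: cos_arctan del: inverse_eq_divide power_inverse)
          then show ?thesis using \<open>cos ?d > 0\<close> by (simp add: field_simps)
        qed
        moreover from this have "sin (arctan (tan ?d)) = sin ?d"
          using \<open>cos ?d > 0\<close> tan_arctan[of "tan ?d"] by (auto simp: tan_def)
        ultimately show ?thesis
          using sin_add[of "\<theta> $ k" "arctan (tan ?d)"] cos_add[of "\<theta> $ k" "arctan (tan ?d)"]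
            sin_add[of "\<theta> $ k" ?d] cos_add[of "\<theta> $ k" ?d] by simp
      qed
      then have "orbit_map x (g y) = orbit_map x \<eta>"
        using * by (intro orbit_map_cong)
      then show ?thesis by (simp add: \<eta>)
    qed
    moreover have "range (orbit_map x) \<inter> (W \<inter> g -` U) \<subseteq> orbit_map x ` U"
    proof
      fix y assume "y \<in> range (orbit_map x) \<inter> (W \<inter> g -` U)"
      then have "orbit_map x (g y) = y" "g y \<in> U"
        using inverse by auto
      then show "y \<in> orbit_map x ` U" by (metis imageI)
    qed
    ultimately show ?thesis
      by (intro exI[of _ "range (orbit_map x) \<inter> (W \<inter> g -` U)"]) (auto intro: openin_open_Int)
  qed
  then show "openin (top_of_set (range (orbit_map x))) (orbit_map x ` U)"
    by (subst openin_subopen) blast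
qed

lemma quotient_map_orbit_map:
  assumes "\<And>i. i \<in> J \<Longrightarrow> action i x \<noteq> 0"
  shows "quotient_map euclidean (top_of_set (range (orbit_map x))) (orbit_map x)"
  by (intro continuous_open_imp_quotient_map open_map_orbit_map assms)
    (auto simp: continuous_map_in_subtopology continuous_on_orbit_map)

text \<open>In the planes these are the signed cyclotron frequencies, the same for all motions;
  along the kernel the entry is the constant drift velocity.\<close>

definition frequency :: "real \<Rightarrow> 'v \<times> 'v \<Rightarrow> real ^ 'k" where
  "frequency m x = (\<chi> j. if j \<in> J then \<mu> j / m else (e j \<bullet> snd x) / m)"

lemma orbit_derivative_frequency:
  "orbit_derivative x \<theta> (frequency m x) = field m (orbit_map x \<theta>)"
proof -
  have A: "A (snd (orbit_map x \<theta>)) = (\<Sum>j\<in>J. \<mu> j *\<^sub>R rot' x \<theta> j)"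
    by (simp add: snd_orbit_map A_simps linear_sum[OF linear_A] A_e A_rot)
  show ?thesis
    using \<mu>_nonzero
    by (auto simp: field_def A orbit_derivative_def fst_sum snd_sum prod_eq_iff)
      (simp_all add: snd_orbit_map frequency_def scaleR_add_right scaleR_sum_right
        cong: sum.cong_simp)
qed

lemma integral_curve_orbit_map: "integral_curve (field m) (\<lambda>t. orbit_map x (\<theta> + t *\<^sub>R frequency m x))"
  unfolding integral_curve_def
proof
  fix t
  have "((\<lambda>t. \<theta> + t *\<^sub>R frequency m x) has_derivative (\<lambda>h. h *\<^sub>R frequency m x)) (at t)"
    by (auto intro!: derivative_eq_intros)
  from has_derivative_compose[OF this orbit_map_derivative]
  have "((\<lambda>t. orbit_map x (\<theta> + t *\<^sub>R frequency m x)) has_derivative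
      (\<lambda>h. orbit_derivative x (\<theta> + t *\<^sub>R frequency m x) (h *\<^sub>R frequency m x))) (at t)"
    by simp
  then show "((\<lambda>t. orbit_map x (\<theta> + t *\<^sub>R frequency m x)) has_vector_derivative
      field m (orbit_map x (\<theta> + t *\<^sub>R frequency m x))) (at t)"
    using linear_scale[OF has_derivative_linear[OF orbit_map_derivative]]
    by (simp add: has_vector_derivative_def orbit_derivative_frequency)
qed

text \<open>At these points the whole level set is a continuous image of a vector space, hence
  already connected.\<close>

lemma level_component_integrals:
  assumes "\<And>i. i \<in> J \<Longrightarrow> action i x \<noteq> 0"
  shows "level_component integrals x = range (orbit_map x)"
proof -
  have "connected (range (orbit_map x))"
    by (intro connected_continuous_image continuous_on_orbit_map connected_UNIV)
  moreover have "x \<in> range (orbit_map x)"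
    using orbit_map_0 by (metis rangeI)
  ultimately show ?thesis
    by (simp add: level_component_def level_set_integrals assms connected_component_eq_self)
qed

theorem quasi_periodic_level_component:
  assumes "\<And>i. i \<in> J \<Longrightarrow> action i x \<noteq> 0"
  shows "quasi_periodic_over twisted (field m) J (level_component integrals x)"
proof -
  have "integral_curve (field m) c \<longleftrightarrow> (\<forall>t. c t = orbit_map x (\<theta> + t *\<^sub>R frequency m x))"
    if "c 0 = orbit_map x \<theta>" for \<theta> c
    using that integral_curve_unique[OF _ integral_curve_orbit_map] integral_curve_orbit_map
    by (metis (no_types, lifting) add.right_neutral ext scaleR_zero_left)
  then show ?thesis
    unfolding quasi_periodic_over_def
    using smooth_orbit_map quotient_map_orbit_map[OF assms] orbit_map_eq_iff[OF assms]
      inj_orbit_derivative[OF assms] isotropic_orbit_map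
    by (intro exI[of _ "orbit_map x"] exI[of _ "frequency m x"])
      (simp add: frechet_derivative_orbit_map level_component_integrals[OF assms])
qed

theorem generic_motions_quasi_periodic_twisted:
  "generic_motions_quasi_periodic twisted (energy m) (field m) J"
proof -
  have "generic (\<lambda>x. quasi_periodic_over twisted (field m) J (level_component integrals x))"
    by (rule generic_mono[OF generic_frame], rule quasi_periodic_level_component)
      (simp add: action_def add_nonneg_eq_0_iff)
  then show ?thesis
    unfolding generic_motions_quasi_periodic_def using nc_integrable_by_integrals by blast
qed

end

subsection \<open>The magnetic system\<close>

lemma sum_pairs:
  "(\<Sum>i = 1..n. f i) = (\<Sum>i = 1..n div 2. f (2 * i - 1) + f (2 * i)) + (if odd n then f n else 0)"
  for f :: "nat \<Rightarrow> 'a::ab_group_add"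
proof (induction n)
  case (Suc n)
  then show ?case
    by (cases "even n") (auto elim!: evenE oddE simp: algebra_simps)
qed simp

text \<open>The vectors span by a dimension count, so the remainder \<open>z\<close>, orthogonal to
  each of them, is orthogonal to itself.\<close>

lemma orthonormal_expansion:
  fixes b :: "nat \<Rightarrow> 'a::euclidean_space"
  assumes "\<And>i j. i \<in> {1..DIM('a)} \<Longrightarrow> j \<in> {1..DIM('a)} \<Longrightarrow> b i \<bullet> b j = (if i = j then 1 else 0)"
  shows "w = (\<Sum>i = 1..DIM('a). (b i \<bullet> w) *\<^sub>R b i)"
proof -
  let ?N = "{1..DIM('a)}"
  have "inj_on b ?N"
    using assms by (intro inj_onI) (metis zero_neq_one)
  moreover have "pairwise orthogonal (b ` ?N)"
    using assms by (auto simp: pairwise_def orthogonal_def)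
  moreover have "0 \<notin> b ` ?N"
    using assms by force
  ultimately have "independent (b ` ?N)" "card (b ` ?N) = DIM('a)"
    using pairwise_orthogonal_independent by (blast, simp add: card_image)
  then have span: "span (b ` ?N) = UNIV"
    by (metis dim_UNIV card_eq_dim independent_imp_finite subset_UNIV top.extremum_uniqueI)
  define z where "z = w - (\<Sum>i = 1..DIM('a). (b i \<bullet> w) *\<^sub>R b i)"
  have "b j \<bullet> z = 0" if "j \<in> ?N" for j
  proof -
    have "(\<Sum>i = 1..DIM('a). (b i \<bullet> w) * (b j \<bullet> b i)) = (\<Sum>i = 1..DIM('a). if i = j then b j \<bullet> w else 0)"
      using that assms by (intro sum.cong) auto
    then show ?thesis
      using that by (simp add: z_def inner_diff_right inner_sum_right)
  qed
  then have "orthogonal z z"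
    by (intro orthogonal_to_span[of z "b ` ?N"], unfold span)
      (auto simp: orthogonal_def inner_commute)
  then show ?thesis by (simp add: z_def orthogonal_self)
qed

lemma wedge_swap: "wedge \<alpha> \<beta> u v = - wedge \<alpha> \<beta> v u"
  by (simp add: wedge_def)

text \<open>In the full double sum the diagonal vanishes by skew-symmetry, and swapping indices
  folds the part \<open>j < i\<close> onto \<open>i < j\<close>, where each pair of terms becomes a
  wedge.\<close>

lemma magnetic_form_eq:
  fixes \<kappa> :: "('n::{finite,linorder}) matrix"
  assumes "transpose \<kappa> = - \<kappa>"
  shows "magnetic_form s \<kappa> u v = u \<bullet> (s *\<^sub>R (\<kappa> *v v))"
proof -
  have skew: "\<kappa> $ j $ i = - \<kappa> $ i $ j" for i j
    using arg_cong[OF assms, of "\<lambda>M. M $ i $ j"] by (simp add: transpose_def)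
  let ?f = "\<lambda>(i, j). u $ i * (\<kappa> $ i $ j * v $ j)"
  let ?L = "{(i, j). i < (j :: 'n)}" and ?G = "{(i, j). j < (i :: 'n)}" and ?D = "{(i, j). i = (j :: 'n)}"
  have "u \<bullet> (\<kappa> *v v) = sum ?f (UNIV \<times> UNIV)"
    by (simp add: inner_vec_def matrix_vector_mult_def sum_distrib_left sum.cartesian_product)
  also have "UNIV \<times> UNIV = ?L \<union> ?G \<union> ?D"
    by auto
  also have "sum ?f (?L \<union> ?G \<union> ?D) = sum ?f (?L \<union> ?G) + sum ?f ?D"
    by (rule sum.union_disjoint) auto
  also have "sum ?f (?L \<union> ?G) = sum ?f ?L + sum ?f ?G"
    by (rule sum.union_disjoint) auto
  also have "sum ?f ?D = 0"
    using skew[of i i for i] by (intro sum.neutral) auto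
  also have "sum ?f ?G = sum (\<lambda>(i, j). u $ j * (\<kappa> $ j $ i * v $ i)) ?L"
    by (rule sum.reindex_bij_witness[of _ prod.swap prod.swap]) auto
  finally have "u \<bullet> (\<kappa> *v v) = (\<Sum>(i, j) \<in> ?L. u $ i * (\<kappa> $ i $ j * v $ j) + u $ j * (\<kappa> $ j $ i * v $ i))"
    by (simp add: sum.distrib case_prod_unfold)
  also have "\<dots> = (\<Sum>(i, j) \<in> ?L. \<kappa> $ i $ j * wedge (\<lambda>w. w $ i) (\<lambda>w. w $ j) u v)"
    unfolding wedge_def
  proof (intro sum.cong refl, clarify)
    fix i j
    show "u $ i * (\<kappa> $ i $ j * v $ j) + u $ j * (\<kappa> $ j $ i * v $ i) =
        \<kappa> $ i $ j * (u $ i * v $ j - v $ i * u $ j)"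
      using skew[of j i] by (simp add: algebra_simps)
  qed
  finally show ?thesis
    by (simp add: magnetic_form_def)
qed

theorem theorem1:
  fixes m s :: real and \<kappa> :: "('n::{finite,linorder}) matrix"
  assumes "m > 0" and "s \<noteq> 0" and "transpose \<kappa> = - \<kappa>"
  shows "nc_integrable (twisted_form s \<kappa>) (kinetic_energy m) (magnetic_field m s \<kappa>) \<and>
    (\<forall>b k. normal_coordinates s \<kappa> b k \<longrightarrow> (\<forall>i\<in>{1..CARD('n) div 2}. k i \<noteq> 0) \<longrightarrow>
      (even CARD('n) \<longrightarrow> CARD('k::finite) = CARD('n) div 2 \<longrightarrow>
         generic_motions_quasi_periodic (twisted_form s \<kappa>) (kinetic_energy m)
           (magnetic_field m s \<kappa>) (UNIV :: 'k set)) \<and>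
      (odd CARD('n) \<longrightarrow> CARD('k) = CARD('n) div 2 + 1 \<longrightarrow>
         (\<forall>j :: 'k. generic_motions_quasi_periodic (twisted_form s \<kappa>) (kinetic_energy m)
           (magnetic_field m s \<kappa>) (- {j}))))"
proof -
  define A where "A v = s *\<^sub>R (\<kappa> *v v)" for v
  note magnetic_form = magnetic_form_eq[OF assms(3), of s, folded A_def]
  have skew: "u \<bullet> A v = - (v \<bullet> A u)" for u v
  proof -
    have "magnetic_form s \<kappa> u v = - magnetic_form s \<kappa> v u"
      unfolding magnetic_form_def wedge_swap[of _ _ u v]
      by (simp add: case_prod_unfold sum_negf)
    then show ?thesis by (simp only: magnetic_form)
  qed
  have "skew_map A"
  proof (rule skew_map.intro)
    show "linear A"
      unfolding A_def
      by (intro linearI) (auto simp: matrix_vector_right_distrib matrix_vector_mult_scaleR algebra_simps)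
    show "A x \<bullet> y = - (x \<bullet> A y)" for x y
      using skew[of y x] by (simp add: inner_commute)
  qed
  then interpret skew_map A .
  have system: "twisted_form s \<kappa> = twisted" "kinetic_energy m = energy m" "magnetic_field m s \<kappa> = field m"
    by (auto simp: fun_eq_iff twisted_form_def canonical_form_def wedge_def twisted_def magnetic_form
        inner_vec_def sum_subtractf kinetic_energy_def energy_def magnetic_field_def field_def A_def)
  have "nc_integrable twisted (energy m) (field m)"
  proof -
    obtain r :: nat and a c \<mu> where "normal_frame A {..<r} a c \<mu>"
      using exists_normal_frame \<open>skew_map A\<close> by blast
    then show ?thesis
      using normal_frame.nc_integrable_by_integrals unfolding nc_integrable_def by blast
  qed
  \<comment> \<open>One claim covers both parities: \<open>J\<close> is everything, or it omits the
    single index of the line factor.\<close>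
  moreover have "generic_motions_quasi_periodic twisted (energy m) (field m) J"
    if coordinates: "normal_coordinates s \<kappa> b k" and nonzero: "\<forall>i\<in>{1..CARD('n) div 2}. k i \<noteq> 0"
      and J: "card J = CARD('n) div 2"
      and complement: "if odd CARD('n) then \<exists>j. - J = {j} else J = UNIV" for b k and J :: "'k set"
  proof -
    let ?r = "CARD('n) div 2"
    have b: "\<And>i j. i \<in> {1..CARD('n)} \<Longrightarrow> j \<in> {1..CARD('n)} \<Longrightarrow> b i \<bullet> b j = (if i = j then 1 else 0)"
      and form: "\<And>u v. magnetic_form s \<kappa> u v =
        s * (\<Sum>i = 1..?r. k i * wedge (\<lambda>w. b (2 * i - 1) \<bullet> w) (\<lambda>w. b (2 * i) \<bullet> w) u v)"
      using coordinates by (auto simp: normal_coordinates_def)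
    obtain \<sigma> where \<sigma>: "bij_betw \<sigma> J {1..?r}"
      using finite_same_card_bij[of J "{1..?r}"] J by auto
    then have \<sigma>_in: "\<sigma> i \<in> {1..?r}" if "i \<in> J" for i
      using that by (auto simp: bij_betw_def)
    have \<sigma>_eq: "\<sigma> i = \<sigma> j \<longleftrightarrow> i = j" if "i \<in> J" "j \<in> J" for i j
      using \<sigma> that by (auto simp: bij_betw_def inj_on_def)
    define a where "a j = b (2 * \<sigma> j - 1)" for j
    define c where "c j = b (2 * \<sigma> j)" for j
    \<comment> \<open>There is an index outside \<open>J\<close> only for odd dimension, and then
      just one; its direction is the last basis vector, which has no partner.\<close>
    define e where "e j = b CARD('n)" for j :: 'k
    have range: "2 * \<sigma> i - 1 \<in> {1..CARD('n)}" "2 * \<sigma> i \<in> {1..CARD('n)}" if "i \<in> J" for i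
      using \<sigma>_in[OF that] by auto
    have distinct: "2 * \<sigma> i - 1 \<noteq> 2 * \<sigma> j" "2 * \<sigma> i - 1 = 2 * \<sigma> j - 1 \<longleftrightarrow> i = j"
      if "i \<in> J" "j \<in> J" for i j
      using \<sigma>_in[OF that(1)] \<sigma>_in[OF that(2)] \<sigma>_eq[OF that] by (auto; presburger)+
    \<comment> \<open>For odd dimension the paired indices stop at one below
      \<open>CARD('n)\<close>, so the last basis vector is orthogonal to all planes.\<close>
    have top: "2 * \<sigma> i - 1 \<noteq> CARD('n)" "2 * \<sigma> i \<noteq> CARD('n)" if "i \<in> J" "odd CARD('n)" for i
      using \<sigma>_in[OF that(1)] that(2) by (auto; presburger)+
    have A_eq: "A w = (\<Sum>i\<in>J. (s * k (\<sigma> i)) *\<^sub>R ((c i \<bullet> w) *\<^sub>R a i - (a i \<bullet> w) *\<^sub>R c i))" for w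
    proof -
      let ?f = "\<lambda>i. (s * k i) *\<^sub>R ((b (2 * i) \<bullet> w) *\<^sub>R b (2 * i - 1) - (b (2 * i - 1) \<bullet> w) *\<^sub>R b (2 * i))"
      \<comment> \<open>The coordinate formula for the two-form becomes one for \<open>A\<close> by
        testing against every \<open>u\<close>.\<close>
      have "u \<bullet> A w = u \<bullet> (\<Sum>i = 1..?r. ?f i)" for u
        unfolding magnetic_form[symmetric] form
        by (auto simp: wedge_def inner_sum_right sum_distrib_left inner_diff_right inner_commute
            algebra_simps intro!: sum.cong)
      then have "A w = (\<Sum>i = 1..?r. ?f i)"
        using vector_eq_ldot by blast
      also have "\<dots> = (\<Sum>i\<in>J. ?f (\<sigma> i))"
        by (rule sum.reindex_bij_betw[OF \<sigma>, symmetric])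
      finally show ?thesis
        by (simp only: a_def c_def)
    qed
    have "normal_frame A J a c (\<lambda>i. s * k (\<sigma> i))"
    proof
      show "s * k (\<sigma> i) \<noteq> 0" if "i \<in> J" for i
        using nonzero \<sigma>_in[OF that] assms(2) by simp
    qed (use A_eq b range distinct \<sigma>_eq in \<open>simp_all add: a_def c_def\<close>)
    then interpret normal_frame A J a c "\<lambda>i. s * k (\<sigma> i)" .
    have kernel: "odd CARD('n)" if "j \<notin> J" for j
      using complement that by (auto split: if_splits)
    have "complete_frame A J a c (\<lambda>i. s * k (\<sigma> i)) e"
    proof
      show "e i \<bullet> e j = (if i = j then 1 else 0)" if "i \<notin> J" "j \<notin> J" for i j
      proof -
        have "i = j"
          using complement that kernel[OF that(1)] by (metis ComplI singletonD)
        then show ?thesis by (simp add: e_def b)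
      qed
      show "e j \<bullet> a i = 0" "e j \<bullet> c i = 0" if "j \<notin> J" "i \<in> J" for i j
        using range[OF that(2)] top[OF that(2) kernel[OF that(1)]] by (simp_all add: e_def a_def c_def b)
      show "w = (\<Sum>i\<in>J. P i w) + (\<Sum>i\<in>-J. (e i \<bullet> w) *\<^sub>R e i)" for w
      proof -
        let ?f = "\<lambda>i. (b i \<bullet> w) *\<^sub>R b i"
        have "w = (\<Sum>i = 1..CARD('n). ?f i)"
          using orthonormal_expansion[of b w] b by simp
        also have "\<dots> = (\<Sum>i = 1..?r. ?f (2 * i - 1) + ?f (2 * i)) + (if odd CARD('n) then ?f CARD('n) else 0)"
          by (rule sum_pairs)
        also have "(\<Sum>i = 1..?r. ?f (2 * i - 1) + ?f (2 * i)) = (\<Sum>i\<in>J. P i w)"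
          unfolding P_def a_def c_def
          by (rule sum.reindex_bij_betw[OF \<sigma>, of "\<lambda>i. ?f (2 * i - 1) + ?f (2 * i)", symmetric])
        also have "(if odd CARD('n) then ?f CARD('n) else 0) = (\<Sum>i\<in>-J. (e i \<bullet> w) *\<^sub>R e i)"
          using complement by (auto simp: e_def)
        finally show ?thesis .
      qed
    qed
    then show ?thesis
      by (rule complete_frame.generic_motions_quasi_periodic_twisted)
  qed
  moreover have "card (- {j}) = CARD('k) - 1" for j :: 'k
    by (simp add: Compl_eq_Diff_UNIV)
  ultimately show ?thesis
    unfolding system by auto
qed

end
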